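(* The NC parallel sum function $$\mathfrak{P}(Z,W)=(I-Z)(2I-Z-W)^{-1}(I-W)=\big((I-Z)^{-1}+(I-W)^{-1}\big)^{-1}$$ is an NC rational function defined on $\mathfrak{D}_2$ such that: it is contractive on $\mathfrak{D}_2$, i.e. $\|\mathfrak{P}(X,Y)\|\le1$ for all $(X,Y)\in\mathfrak{D}_2$; it is $\mathfrak{D}_2$-stable, i.e. $\det\mathfrak{P}(X,Y)\ne0$ for all $(X,Y)\in\mathfrak{D}_2$; it is accretive, i.e. $\operatorname{Re}\mathfrak{P}(X,Y)\succeq0$ for all $(X,Y)\in\mathfrak{D}_2$; and it cannot be extended uniformly across the boundary of $\mathfrak{D}_2$, i.e. there is no $s>1$ with $s\mathfrak{D}_2\subset\operatorname{dom}\mathfrak{P}$. Moreover, $\mathfrak{P}$ is left cyclic and right cyclic in $H^\infty(\mathfrak{D}_2)$.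
   Context: Write $M_n$ for the complex $n\times n$ matrices, $M_n^2$ for pairs of such matrices, and $\mathbb{M}^d=\bigsqcup_{n\ge1}M_n^d$. The NC unit bidisk is $\mathfrak{D}_2=\{(X,Y)\in\mathbb{M}^2:\max(\|X\|,\|Y\|)<1\}$, $\mathfrak{D}_2(n)=\mathfrak{D}_2\cap M_n^2$, and $s\mathfrak{D}_2=\{(sX,sY):(X,Y)\in\mathfrak{D}_2\}$. $\operatorname{Re}A=\tfrac12(A+A^* )$. NC rational functions: an NC rational expression in $Z,W$ is any syntactically valid expression built from free (non-commutative) polynomials over $\mathbb{C}$ by addition, multiplication and inversion. Its domain is the set of points of $\mathbb{M}^2$ at which it can be evaluated (all inverses occurring exist); it is non-degenerate if its domain is non-empty. Two non-degenerate expressions are equivalent if they take the same values at every point in the intersection of their domains. An NC rational function is an equivalence class of non-degenerate expressions; its domain $\operatorname{dom}$ is the union of the domains of the expressions in the class. A function $F:\mathfrak{D}_2\to\mathbb{M}^1$ is NC if $F(X)\in M_n$ for $X\in\mathfrak{D}_2(n)$, $F(X\oplus Y)=F(X)\oplus F(Y)$ for $X,Y\in\mathfrak{D}_2$, and $F(S^{-1}XS)=S^{-1}F(X)S$ whenever $X,S^{-1}XS\in\mathfrak{D}_2(n)$, $S\in GL_n$ (operations on pairs are componentwise). $H^\infty(\mathfrak{D}_2)$ is the Banach algebra of NC functions on $\mathfrak{D}_2$ with $\|F\|=\sup_{X\in\mathfrak{D}_2}\|F(X)\|<\infty$. Let $\mathcal{X}$ be the norm-closed span in $(H^\infty(\mathfrak{D}_2))^*$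 of all functionals $F\mapsto\eta(F(X))$ with $n\in\mathbb{N}$, $X\in\mathfrak{D}_2(n)$, $\eta\in M_n^*$; it is a pre-dual of $H^\infty(\mathfrak{D}_2)$, and the weak-* topology is $\sigma(H^\infty(\mathfrak{D}_2),\mathcal{X})$. $F\in H^\infty(\mathfrak{D}_2)$ is left (resp. right) cyclic if $\{GF:G\in H^\infty(\mathfrak{D}_2)\}$ (resp. $\{FG:G\in H^\infty(\mathfrak{D}_2)\}$) is weak-* dense in $H^\infty(\mathfrak{D}_2)$. *)

theory Defs
  imports
    "HOL-Library.FuncSet"
    "HOL-Library.Poly_Mapping"
    "HOL-Analysis.Function_Topology"
    "Jordan_Normal_Form.Determinant"
    "Jordan_Normal_Form.Gauss_Jordan_Elimination"
    "Jordan_Normal_Form.Schur_Decomposition"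
begin

section \<open>Matrices of all sizes\<close>

text \<open>
  Matrices are those of \<open>Jordan_Normal_Form\<close>, whose size is a value and not a type, so that points
  of different sizes live in one type. That library admits \<open>0 \<times> 0\<close> matrices; they are
  excluded from \<open>nc_points\<close>.
\<close>

type_synonym mat_pair = "complex mat \<times> complex mat"

definition vec_norm :: "complex vec \<Rightarrow> real" where
  "vec_norm v = sqrt (Re (v \<bullet>c v))"

definition op_norm :: "complex mat \<Rightarrow> real" where
  "op_norm A = (SUP v \<in> {v \<in> carrier_vec (dim_col A). vec_norm v \<le> 1}. vec_norm (A *\<^sub>v v))"

definition re_part :: "complex mat \<Rightarrow> complex mat" where
  "re_part A = (1 / 2) \<cdot>\<^sub>m (A + mat_adjoint A)"

text \<open>\<open>\<le>\<close> on \<open>complex\<close> is that of \<open>HOL-Library.Complex_Order\<close>: \<open>0 \<le> z\<close> says that \<open>z\<close> is real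
  and non-negative.\<close>

definition psd :: "complex mat \<Rightarrow> bool" where
  "psd A \<longleftrightarrow> square_mat A \<and> mat_adjoint A = A \<and>
     (\<forall>v \<in> carrier_vec (dim_row A). 0 \<le> (A *\<^sub>v v) \<bullet>c v)"

definition mat_dsum :: "complex mat \<Rightarrow> complex mat \<Rightarrow> complex mat" where
  "mat_dsum A B = four_block_mat A (0\<^sub>m (dim_row A) (dim_col B)) (0\<^sub>m (dim_row B) (dim_col A)) B"

section \<open>The NC bidisk\<close>

definition nc_points :: "mat_pair set" where
  "nc_points = (\<Union>n \<in> {1..}. carrier_mat n n \<times> carrier_mat n n)"

definition bidisk :: "mat_pair set" where
  "bidisk = {(X, Y) \<in> nc_points. max (op_norm X) (op_norm Y) < 1}"

definition bidisk_level :: "nat \<Rightarrow> mat_pair set" where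
  "bidisk_level n = bidisk \<inter> (carrier_mat n n \<times> carrier_mat n n)"

definition scaled_bidisk :: "real \<Rightarrow> mat_pair set" where
  "scaled_bidisk s = (\<lambda>(X, Y). (of_real s \<cdot>\<^sub>m X, of_real s \<cdot>\<^sub>m Y)) ` bidisk"

section \<open>NC rational functions\<close>

datatype nc_var = VarZ | VarW

text \<open>A free polynomial is a finitely supported family of coefficients indexed by words.\<close>

type_synonym free_poly = "nc_var list \<Rightarrow>\<^sub>0 complex"

datatype nc_expr =
    Poly free_poly
  | Add nc_expr nc_expr
  | Mult nc_expr nc_expr
  | Inv nc_expr

fun var_eval :: "nc_var \<Rightarrow> mat_pair \<Rightarrow> complex mat" where
  "var_eval VarZ (X, Y) = X"
| "var_eval VarW (X, Y) = Y"

definition word_eval :: "nc_var list \<Rightarrow> mat_pair \<Rightarrow> complex mat" where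
  "word_eval w P = foldr (\<lambda>x A. var_eval x P * A) w (1\<^sub>m (dim_row (fst P)))"

definition poly_eval :: "free_poly \<Rightarrow> mat_pair \<Rightarrow> complex mat" where
  "poly_eval p P = mat (dim_row (fst P)) (dim_row (fst P))
     (\<lambda>ij. \<Sum>w \<in> Poly_Mapping.keys p. Poly_Mapping.lookup p w * (word_eval w P $$ ij))"

text \<open>\<open>None\<close> means that some inverse occurring in the expression does not exist;
  \<open>mat_inverse A\<close> is \<open>None\<close> exactly when \<open>A\<close> is not invertible.\<close>

fun expr_eval :: "nc_expr \<Rightarrow> mat_pair \<Rightarrow> complex mat option" where
  "expr_eval (Poly p) P = Some (poly_eval p P)"
| "expr_eval (Add a b) P =
     (case (expr_eval a P, expr_eval b P) of (Some A, Some B) \<Rightarrow> Some (A + B) | _ \<Rightarrow> None)"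
| "expr_eval (Mult a b) P =
     (case (expr_eval a P, expr_eval b P) of (Some A, Some B) \<Rightarrow> Some (A * B) | _ \<Rightarrow> None)"
| "expr_eval (Inv a) P =
     (case expr_eval a P of Some A \<Rightarrow> mat_inverse A | None \<Rightarrow> None)"

definition expr_dom :: "nc_expr \<Rightarrow> mat_pair set" where
  "expr_dom e = {P \<in> nc_points. expr_eval e P \<noteq> None}"

definition nondegenerate :: "nc_expr set" where
  "nondegenerate = {e. expr_dom e \<noteq> {}}"

definition expr_equiv :: "(nc_expr \<times> nc_expr) set" where
  "expr_equiv = {(a, b). a \<in> nondegenerate \<and> b \<in> nondegenerate \<and>
     (\<forall>P \<in> expr_dom a \<inter> expr_dom b. expr_eval a P = expr_eval b P)}"

definition nc_rational_functions :: "nc_expr set set" where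
  "nc_rational_functions = nondegenerate // expr_equiv"

definition rat_dom :: "nc_expr set \<Rightarrow> mat_pair set" where
  "rat_dom r = (\<Union>e \<in> r. expr_dom e)"

text \<open>Any expression of the class that is defined at \<open>P\<close> may be used to evaluate it there: equivalent
  expressions agree wherever both are defined.\<close>

definition rat_apply :: "nc_expr set \<Rightarrow> mat_pair \<Rightarrow> complex mat" where
  "rat_apply r P = the (expr_eval (SOME e. e \<in> r \<and> P \<in> expr_dom e) P)"

section \<open>The algebra of bounded NC functions on the bidisk\<close>

definition nc_function :: "(mat_pair \<Rightarrow> complex mat) \<Rightarrow> bool" where
  "nc_function F \<longleftrightarrow>
     (\<forall>n. \<forall>P \<in> bidisk_level n. F P \<in> carrier_mat n n) \<and>
     (\<forall>(X1, X2) \<in> bidisk. \<forall>(Y1, Y2) \<in> bidisk.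
        F (mat_dsum X1 Y1, mat_dsum X2 Y2) = mat_dsum (F (X1, X2)) (F (Y1, Y2))) \<and>
     (\<forall>n. \<forall>(X, Y) \<in> bidisk_level n. \<forall>S \<in> carrier_mat n n. \<forall>T \<in> carrier_mat n n.
        inverts_mat S T \<and> inverts_mat T S \<and> (T * X * S, T * Y * S) \<in> bidisk_level n \<longrightarrow>
        F (T * X * S, T * Y * S) = T * F (X, Y) * S)"

text \<open>Functions on the bidisk are represented by extensional functions, so that equality in
  \<open>hinf\<close> is equality on the bidisk; functionals on \<open>hinf\<close> are treated in the same way.\<close>

definition hinf :: "(mat_pair \<Rightarrow> complex mat) set" where
  "hinf = {F \<in> extensional bidisk. nc_function F \<and> bdd_above ((\<lambda>P. op_norm (F P)) ` bidisk)}"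

definition hinf_norm :: "(mat_pair \<Rightarrow> complex mat) \<Rightarrow> real" where
  "hinf_norm F = (SUP P \<in> bidisk. op_norm (F P))"

definition hinf_mult ::
  "(mat_pair \<Rightarrow> complex mat) \<Rightarrow> (mat_pair \<Rightarrow> complex mat) \<Rightarrow> mat_pair \<Rightarrow> complex mat" where
  "hinf_mult F G = (\<lambda>P \<in> bidisk. F P * G P)"

definition hinf_dual :: "((mat_pair \<Rightarrow> complex mat) \<Rightarrow> complex) set" where
  "hinf_dual = {\<phi> \<in> extensional hinf.
     (\<forall>F \<in> hinf. \<forall>G \<in> hinf. \<forall>a b.
        \<phi> (\<lambda>P \<in> bidisk. a \<cdot>\<^sub>m F P + b \<cdot>\<^sub>m G P) = a * \<phi> F + b * \<phi> G) \<and>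
     (\<exists>C. \<forall>F \<in> hinf. cmod (\<phi> F) \<le> C * hinf_norm F)}"

definition dual_norm :: "((mat_pair \<Rightarrow> complex mat) \<Rightarrow> complex) \<Rightarrow> real" where
  "dual_norm \<phi> = (SUP F \<in> {F \<in> hinf. hinf_norm F \<le> 1}. cmod (\<phi> F))"

definition mat_functionals :: "nat \<Rightarrow> (complex mat \<Rightarrow> complex) set" where
  "mat_functionals n = {\<eta>. \<forall>A \<in> carrier_mat n n. \<forall>B \<in> carrier_mat n n. \<forall>a b.
     \<eta> (a \<cdot>\<^sub>m A + b \<cdot>\<^sub>m B) = a * \<eta> A + b * \<eta> B}"

definition point_functionals :: "((mat_pair \<Rightarrow> complex mat) \<Rightarrow> complex) set" where
  "point_functionals =
     {(\<lambda>F \<in> hinf. \<eta> (F P)) | n P \<eta>. P \<in> bidisk_level n \<and> \<eta> \<in> mat_functionals n}"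

definition point_span :: "((mat_pair \<Rightarrow> complex mat) \<Rightarrow> complex) set" where
  "point_span =
     {(\<lambda>F \<in> hinf. \<Sum>\<phi> \<in> A. c \<phi> * \<phi> F) | A c. finite A \<and> A \<subseteq> point_functionals}"

definition predual :: "((mat_pair \<Rightarrow> complex mat) \<Rightarrow> complex) set" where
  "predual = {\<phi> \<in> hinf_dual. \<forall>\<epsilon>>0. \<exists>\<psi> \<in> point_span. dual_norm (\<lambda>F. \<phi> F - \<psi> F) < \<epsilon>}"

definition weak_star :: "(mat_pair \<Rightarrow> complex mat) topology" where
  "weak_star = topology_generated_by {{F \<in> hinf. \<phi> F \<in> U} | \<phi> U. \<phi> \<in> predual \<and> open U}"

definition weak_star_dense :: "(mat_pair \<Rightarrow> complex mat) set \<Rightarrow> bool" where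
  "weak_star_dense S \<longleftrightarrow> weak_star closure_of S = hinf"

definition left_cyclic :: "(mat_pair \<Rightarrow> complex mat) \<Rightarrow> bool" where
  "left_cyclic F \<longleftrightarrow> F \<in> hinf \<and> weak_star_dense {hinf_mult G F | G. G \<in> hinf}"

definition right_cyclic :: "(mat_pair \<Rightarrow> complex mat) \<Rightarrow> bool" where
  "right_cyclic F \<longleftrightarrow> F \<in> hinf \<and> weak_star_dense {hinf_mult F G | G. G \<in> hinf}"

section \<open>Properties of NC rational functions on the bidisk\<close>

definition contractive_on_bidisk :: "nc_expr set \<Rightarrow> bool" where
  "contractive_on_bidisk r \<longleftrightarrow> (\<forall>P \<in> bidisk. op_norm (rat_apply r P) \<le> 1)"

definition bidisk_stable :: "nc_expr set \<Rightarrow> bool" where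
  "bidisk_stable r \<longleftrightarrow> (\<forall>P \<in> bidisk. Determinant.det (rat_apply r P) \<noteq> 0)"

definition accretive_on_bidisk :: "nc_expr set \<Rightarrow> bool" where
  "accretive_on_bidisk r \<longleftrightarrow> (\<forall>P \<in> bidisk. psd (re_part (rat_apply r P)))"

section \<open>The NC parallel sum\<close>

definition const_poly :: "complex \<Rightarrow> free_poly" where
  "const_poly c = Poly_Mapping.single [] c"

definition var_poly :: "nc_var \<Rightarrow> free_poly" where
  "var_poly x = Poly_Mapping.single [x] 1"

definition parallel_sum_expr :: nc_expr where
  "parallel_sum_expr =
     Mult (Mult (Poly (const_poly 1 - var_poly VarZ))
                (Inv (Poly (const_poly 2 - var_poly VarZ - var_poly VarW))))
          (Poly (const_poly 1 - var_poly VarW))"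

definition parallel_sum_expr' :: nc_expr where
  "parallel_sum_expr' =
     Inv (Add (Inv (Poly (const_poly 1 - var_poly VarZ))) (Inv (Poly (const_poly 1 - var_poly VarW))))"

definition parallel_sum :: "nc_expr set" where
  "parallel_sum = expr_equiv `` {parallel_sum_expr}"

end

theory Submission
  imports Defs "HOL-Analysis.L2_Norm"
begin

text \<open>
  All matrix properties of the parallel sum come from one inequality. Let \<open>(X, Y)\<close> be a point of the
  bidisk, \<open>A = 1 - X\<close> and \<open>B = 1 - Y\<close>. Since \<open>X\<close> and \<open>Y\<close> are strict contractions, \<open>A\<close>, \<open>B\<close> and
  \<open>A + B\<close> are bounded below, hence invertible, and
  \<open>A\<^sup>-\<^sup>1 + B\<^sup>-\<^sup>1 = B\<^sup>-\<^sup>1 (A + B) A\<^sup>-\<^sup>1\<close> shows that the two expressions for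
  \<open>Q = A (A + B)\<^sup>-\<^sup>1 B\<close> agree (\<open>parallel_sum_inverse\<close>). The inverse of \<open>1 - X\<close> has real part at least
  \<open>1/2\<close> (\<open>re_inverse_one_minus_contraction\<close>), so \<open>Q\<^sup>-\<^sup>1\<close> has real part at least \<open>1\<close>, which for \<open>Q\<close> reads
  \<open>\<parallel>Q v\<parallel>\<^sup>2 \<le> Re \<langle>Q v, v\<rangle>\<close> (\<open>parallel_sum_firmly_contractive\<close>). Accretivity is immediate from this, and
  contractivity follows by the Cauchy-Schwarz inequality.

  Cyclicity holds for every accretive \<open>F\<close> in the algebra all of whose values are invertible
  (\<open>cyclic_if_accretive_invertible\<close>). For \<open>c > 0\<close> the resolvent \<open>K = (F + c)\<^sup>-\<^sup>1\<close> is again a bounded NC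
  function, \<open>K F\<close> is contractive, and \<open>K F = 1 - c K\<close> tends to \<open>1\<close> at every point as \<open>c\<close> tends to \<open>0\<close>,
  because the norm of \<open>K\<close> at a point is at most that of \<open>F\<^sup>-\<^sup>1\<close> there. So \<open>G K F\<close> and \<open>F K G\<close> tend to \<open>G\<close>
  boundedly and pointwise. Such convergence implies weak-* convergence (\<open>predual_tendsto\<close>): an
  element of the predual is, uniformly on bounded sets, a limit of combinations of point functionals.

  The obstruction to extending the domain is the scalar point \<open>(1, 1)\<close>, which lies in
  every dilation of the bidisk by \<open>s > 1\<close>. An expression that can be evaluated there
  can be evaluated at all nearby scalar points and is continuous there (\<open>expr_eval_scalar_tendsto\<close>), whereas
  \<open>(1 - z) (1 - w) / (2 - z - w)\<close> is unbounded along a curve that ends at \<open>(1, 1)\<close> and is tangent to the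
  line \<open>z + w = 2\<close> (\<open>parallel_sum_singular_at_one\<close>).
\<close>

section \<open>The Hermitian inner product and the operator norm\<close>

lemma cscalar_prod_sum:
  fixes u v :: "complex vec"
  assumes "u \<in> carrier_vec n" "v \<in> carrier_vec n"
  shows "u \<bullet>c v = (\<Sum>i<n. u $ i * cnj (v $ i))"
  using assms by (auto simp: scalar_prod_def lessThan_atLeast0 intro!: sum.cong)

lemma vec_norm_eq_L2_set:
  assumes "v \<in> carrier_vec n"
  shows "vec_norm v = L2_set (\<lambda>i. cmod (v $ i)) {..<n}"
  unfolding vec_norm_def L2_set_def cscalar_prod_sum[OF assms assms]
  by (simp add: complex_mult_cnj cmod_power2 flip: of_real_power of_real_add)

lemma vec_norm_nonneg: "0 \<le> vec_norm v"
  by (simp add: vec_norm_eq_L2_set[OF carrier_vec_dim_vec])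

lemma vec_norm_power2:
  assumes "v \<in> carrier_vec n"
  shows "(vec_norm v)\<^sup>2 = Re (v \<bullet>c v)"
  using vec_norm_nonneg[of v] conjugate_square_ge_0_vec[of v]
  unfolding vec_norm_def by (simp add: less_eq_complex_def)

lemma vec_norm_eq_0_iff:
  assumes "v \<in> carrier_vec n"
  shows "vec_norm v = 0 \<longleftrightarrow> v = 0\<^sub>v n"
  unfolding vec_norm_eq_L2_set[OF assms]
  using assms by (auto simp: L2_set_eq_0_iff)

lemma vec_norm_smult: "vec_norm (c \<cdot>\<^sub>v v) = cmod c * vec_norm v"
proof -
  have v: "v \<in> carrier_vec (dim_vec v)" by auto
  then have "c \<cdot>\<^sub>v v \<in> carrier_vec (dim_vec v)" by auto
  then show ?thesis
    unfolding vec_norm_eq_L2_set[OF v] by (subst vec_norm_eq_L2_set)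
      (auto simp: L2_set_right_distrib norm_mult intro!: L2_set_cong)
qed

lemma vec_norm_triangle:
  assumes "u \<in> carrier_vec n" "v \<in> carrier_vec n"
  shows "vec_norm (u + v) \<le> vec_norm u + vec_norm v"
proof -
  have uv: "u + v \<in> carrier_vec n" using assms by auto
  have "vec_norm (u + v) \<le> L2_set (\<lambda>i. cmod (u $ i) + cmod (v $ i)) {..<n}"
    unfolding vec_norm_eq_L2_set[OF uv]
    by (rule L2_set_mono) (use assms in \<open>auto intro: norm_triangle_ineq\<close>)
  also have "\<dots> \<le> vec_norm u + vec_norm v"
    unfolding vec_norm_eq_L2_set[OF assms(1)] vec_norm_eq_L2_set[OF assms(2)]
    by (rule L2_set_triangle_ineq)
  finally show ?thesis .
qed

lemma vec_norm_diff_triangle: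
  assumes "u \<in> carrier_vec n" "v \<in> carrier_vec n"
  shows "vec_norm u - vec_norm v \<le> vec_norm (u - v)"
proof -
  have "u = (u - v) + v" using assms by auto
  then show ?thesis using vec_norm_triangle[of "u - v" n v] assms by auto
qed

lemma Cauchy_Schwarz_vec:
  assumes "u \<in> carrier_vec n" "v \<in> carrier_vec n"
  shows "cmod (u \<bullet>c v) \<le> vec_norm u * vec_norm v"
proof -
  have "cmod (u \<bullet>c v) \<le> (\<Sum>i<n. cmod (u $ i) * cmod (v $ i))"
    unfolding cscalar_prod_sum[OF assms]
    by (rule sum_norm_le) (simp add: norm_mult)
  also have "\<dots> \<le> vec_norm u * vec_norm v"
    unfolding vec_norm_eq_L2_set[OF assms(1)] vec_norm_eq_L2_set[OF assms(2)]
    using L2_set_mult_ineq[of "\<lambda>i. cmod (u $ i)" "\<lambda>i. cmod (v $ i)" "{..<n}"] by simp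
  finally show ?thesis .
qed

lemma cscalar_prod_add_right:
  fixes u v w :: "complex vec"
  assumes "u \<in> carrier_vec n" "v \<in> carrier_vec n" "w \<in> carrier_vec n"
  shows "u \<bullet>c (v + w) = u \<bullet>c v + u \<bullet>c w"
proof -
  have "v + w \<in> carrier_vec n" using assms by simp
  then show ?thesis
    using assms by (simp add: cscalar_prod_sum[of _ n] algebra_simps sum.distrib)
qed

lemma cscalar_prod_smult_right:
  fixes u v :: "complex vec"
  assumes "u \<in> carrier_vec n" "v \<in> carrier_vec n"
  shows "u \<bullet>c (c \<cdot>\<^sub>v v) = cnj c * (u \<bullet>c v)"
proof -
  have "c \<cdot>\<^sub>v v \<in> carrier_vec n" using assms by simp
  then show ?thesis
    using assms by (simp add: cscalar_prod_sum[of _ n] sum_distrib_left mult_ac)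
qed

lemma vec_norm_power2_add:
  assumes "u \<in> carrier_vec n" "v \<in> carrier_vec n"
  shows "(vec_norm (u + v))\<^sup>2 = (vec_norm u)\<^sup>2 + 2 * Re (u \<bullet>c v) + (vec_norm v)\<^sup>2"
proof -
  have uv: "u + v \<in> carrier_vec n" using assms by auto
  have "Re ((u + v) $ i * cnj ((u + v) $ i))
      = Re (u $ i * cnj (u $ i)) + 2 * Re (u $ i * cnj (v $ i)) + Re (v $ i * cnj (v $ i))"
    if "i < n" for i
    using that assms by (simp add: algebra_simps)
  then have "(\<Sum>i<n. Re ((u + v) $ i * cnj ((u + v) $ i)))
      = (\<Sum>i<n. Re (u $ i * cnj (u $ i)) + 2 * Re (u $ i * cnj (v $ i)) + Re (v $ i * cnj (v $ i)))"
    by (intro sum.cong) auto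
  then show ?thesis
    unfolding vec_norm_power2[OF uv] vec_norm_power2[OF assms(1)] vec_norm_power2[OF assms(2)]
      cscalar_prod_sum[OF uv uv] cscalar_prod_sum[OF assms(1) assms(1)]
      cscalar_prod_sum[OF assms(2) assms(2)] cscalar_prod_sum[OF assms]
      Re_sum sum.distrib sum_distrib_left .
qed

lemma vec_norm_append:
  assumes "u \<in> carrier_vec n" "v \<in> carrier_vec m"
  shows "(vec_norm (u @\<^sub>v v))\<^sup>2 = (vec_norm u)\<^sup>2 + (vec_norm v)\<^sup>2"
proof -
  have conj: "conjugate (u @\<^sub>v v) = conjugate u @\<^sub>v conjugate v"
    using assms by (intro eq_vecI) (auto simp: index_append_vec)
  have "(u @\<^sub>v v) \<bullet>c (u @\<^sub>v v) = u \<bullet>c u + v \<bullet>c v"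
    unfolding conj by (rule scalar_prod_append) (use assms in auto)
  then show ?thesis
    using vec_norm_power2[of "u @\<^sub>v v" "n + m"] assms vec_norm_power2[of u n] vec_norm_power2[of v m]
    by auto
qed

text \<open>This crude bound shows that the supremum in \<^const>\<open>op_norm\<close> is taken over a bounded set.\<close>

lemma vec_norm_mult_mat_vec_le_entries:
  assumes A: "A \<in> carrier_mat m n" and v: "v \<in> carrier_vec n"
  shows "vec_norm (A *\<^sub>v v) \<le> (\<Sum>i<m. \<Sum>j<n. cmod (A $$ (i, j))) * vec_norm v"
proof -
  have Av: "A *\<^sub>v v \<in> carrier_vec m" by (rule mult_mat_vec_carrier[OF A v])
  have entry: "cmod (v $ j) \<le> vec_norm v" if "j < n" for j
    unfolding vec_norm_eq_L2_set[OF v]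
    by (rule member_le_L2_set[of "{..<n}" j "\<lambda>i. cmod (v $ i)"]) (use that in auto)
  have "vec_norm (A *\<^sub>v v) \<le> (\<Sum>i<m. cmod ((A *\<^sub>v v) $ i))"
    unfolding vec_norm_eq_L2_set[OF Av] by (rule L2_set_le_sum) simp
  also have "\<dots> \<le> (\<Sum>i<m. \<Sum>j<n. cmod (A $$ (i, j)) * vec_norm v)"
  proof (rule sum_mono)
    fix i assume "i \<in> {..<m}"
    then have "(A *\<^sub>v v) $ i = (\<Sum>j<n. A $$ (i, j) * v $ j)"
      using A v by (auto simp: scalar_prod_def lessThan_atLeast0 intro!: sum.cong)
    then have "cmod ((A *\<^sub>v v) $ i) \<le> (\<Sum>j<n. cmod (A $$ (i, j) * v $ j))"
      by (simp add: norm_sum)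
    also have "\<dots> \<le> (\<Sum>j<n. cmod (A $$ (i, j)) * vec_norm v)"
      by (rule sum_mono) (auto simp: norm_mult intro!: mult_left_mono entry)
    finally show "cmod ((A *\<^sub>v v) $ i) \<le> \<dots>" .
  qed
  also have "\<dots> = (\<Sum>i<m. \<Sum>j<n. cmod (A $$ (i, j))) * vec_norm v"
    by (simp add: sum_distrib_right)
  finally show ?thesis .
qed

lemma vec_norm_0 [simp]: "vec_norm (0\<^sub>v n) = 0"
  by (subst vec_norm_eq_0_iff[of _ n]) auto

lemma bdd_above_op_norm:
  "bdd_above ((\<lambda>v. vec_norm (A *\<^sub>v v)) ` {v \<in> carrier_vec (dim_col A). vec_norm v \<le> 1})"
proof (rule bdd_aboveI2)
  let ?C = "\<Sum>i<dim_row A. \<Sum>j<dim_col A. cmod (A $$ (i, j))"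
  fix v assume v: "v \<in> {v \<in> carrier_vec (dim_col A). vec_norm v \<le> 1}"
  have "vec_norm (A *\<^sub>v v) \<le> ?C * vec_norm v"
    by (rule vec_norm_mult_mat_vec_le_entries) (use v in auto)
  also have "\<dots> \<le> ?C * 1"
    by (rule mult_left_mono) (use v in \<open>auto intro!: sum_nonneg\<close>)
  finally show "vec_norm (A *\<^sub>v v) \<le> ?C" by simp
qed

lemma op_norm_nonneg: "0 \<le> op_norm A"
proof -
  have "vec_norm (A *\<^sub>v 0\<^sub>v (dim_col A)) \<le> op_norm A"
    unfolding op_norm_def by (rule cSUP_upper[OF _ bdd_above_op_norm]) auto
  then show ?thesis using vec_norm_nonneg[of "A *\<^sub>v 0\<^sub>v (dim_col A)"] by linarith
qed

lemma vec_norm_mult_mat_vec_le: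
  assumes A: "A \<in> carrier_mat m n" and v: "v \<in> carrier_vec n"
  shows "vec_norm (A *\<^sub>v v) \<le> op_norm A * vec_norm v"
proof (cases "vec_norm v = 0")
  case True
  then show ?thesis using vec_norm_mult_mat_vec_le_entries[OF A v] by simp
next
  case False
  then have pos: "0 < vec_norm v" using vec_norm_nonneg[of v] by linarith
  let ?u = "complex_of_real (1 / vec_norm v) \<cdot>\<^sub>v v"
  have "vec_norm (A *\<^sub>v ?u) \<le> op_norm A"
    unfolding op_norm_def
    by (rule cSUP_upper[OF _ bdd_above_op_norm]) (use A v pos in \<open>auto simp: vec_norm_smult norm_divide\<close>)
  then show ?thesis
    using pos unfolding mult_mat_vec[OF A v] vec_norm_smult
    by (simp add: norm_divide field_simps)
qed

lemma op_norm_le: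
  assumes A: "A \<in> carrier_mat m n" and "0 \<le> c"
    and le: "\<And>v. v \<in> carrier_vec n \<Longrightarrow> vec_norm (A *\<^sub>v v) \<le> c * vec_norm v"
  shows "op_norm A \<le> c"
  unfolding op_norm_def
proof (rule cSUP_least)
  have "0\<^sub>v (dim_col A) \<in> {v \<in> carrier_vec (dim_col A). vec_norm v \<le> 1}" by simp
  then show "{v \<in> carrier_vec (dim_col A). vec_norm v \<le> 1} \<noteq> {}" by blast
  fix v assume "v \<in> {v \<in> carrier_vec (dim_col A). vec_norm v \<le> 1}"
  then show "vec_norm (A *\<^sub>v v) \<le> c"
    using le[of v] A mult_left_mono[of "vec_norm v" 1 c] \<open>0 \<le> c\<close> by auto
qed

lemma op_norm_mult_le:
  assumes A: "A \<in> carrier_mat l m" and B: "B \<in> carrier_mat m n"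
  shows "op_norm (A * B) \<le> op_norm A * op_norm B"
proof (rule op_norm_le)
  show "A * B \<in> carrier_mat l n" using A B by simp
  show "0 \<le> op_norm A * op_norm B" by (simp add: op_norm_nonneg)
  fix v :: "complex vec" assume v: "v \<in> carrier_vec n"
  have "vec_norm (A * B *\<^sub>v v) = vec_norm (A *\<^sub>v (B *\<^sub>v v))"
    using assoc_mult_mat_vec[OF A B v] by simp
  also have "\<dots> \<le> op_norm A * vec_norm (B *\<^sub>v v)"
    by (rule vec_norm_mult_mat_vec_le[OF A mult_mat_vec_carrier[OF B v]])
  also have "\<dots> \<le> op_norm A * (op_norm B * vec_norm v)"
    by (rule mult_left_mono[OF vec_norm_mult_mat_vec_le[OF B v] op_norm_nonneg])
  finally show "vec_norm (A * B *\<^sub>v v) \<le> op_norm A * op_norm B * vec_norm v" by simp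
qed

lemma op_norm_lincomb_le:
  assumes A: "A \<in> carrier_mat m n" and B: "B \<in> carrier_mat m n"
  shows "op_norm (a \<cdot>\<^sub>m A + b \<cdot>\<^sub>m B) \<le> cmod a * op_norm A + cmod b * op_norm B"
proof (rule op_norm_le)
  show "a \<cdot>\<^sub>m A + b \<cdot>\<^sub>m B \<in> carrier_mat m n" using A B by simp
  show "0 \<le> cmod a * op_norm A + cmod b * op_norm B" by (simp add: op_norm_nonneg)
  fix v :: "complex vec" assume v: "v \<in> carrier_vec n"
  have "(a \<cdot>\<^sub>m A + b \<cdot>\<^sub>m B) *\<^sub>v v = a \<cdot>\<^sub>v (A *\<^sub>v v) + b \<cdot>\<^sub>v (B *\<^sub>v v)"
    using A B v by (intro eq_vecI) (auto simp: add_scalar_prod_distrib[of _ n])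
  then have "vec_norm ((a \<cdot>\<^sub>m A + b \<cdot>\<^sub>m B) *\<^sub>v v)
      \<le> cmod a * vec_norm (A *\<^sub>v v) + cmod b * vec_norm (B *\<^sub>v v)"
    using vec_norm_triangle[of "a \<cdot>\<^sub>v (A *\<^sub>v v)" m "b \<cdot>\<^sub>v (B *\<^sub>v v)"]
      mult_mat_vec_carrier[OF A v] mult_mat_vec_carrier[OF B v]
    by (simp add: vec_norm_smult)
  also have "\<dots> \<le> cmod a * (op_norm A * vec_norm v) + cmod b * (op_norm B * vec_norm v)"
    by (intro add_mono mult_left_mono vec_norm_mult_mat_vec_le[OF A v]
        vec_norm_mult_mat_vec_le[OF B v]) auto
  finally show "vec_norm ((a \<cdot>\<^sub>m A + b \<cdot>\<^sub>m B) *\<^sub>v v)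
      \<le> (cmod a * op_norm A + cmod b * op_norm B) * vec_norm v"
    by (simp add: algebra_simps)
qed

lemma entry_le_op_norm:
  assumes A: "A \<in> carrier_mat m n" and "i < m" "j < n"
  shows "cmod (A $$ (i, j)) \<le> op_norm A"
proof -
  have uc: "unit_vec n j \<in> carrier_vec n" by auto
  have "(unit_vec n j :: complex vec) \<bullet>c unit_vec n j = 1"
    unfolding cscalar_prod_sum[OF uc uc] using \<open>j < n\<close>
    by (subst sum.cong[OF refl, of _ _ "\<lambda>i. if i = j then 1 else 0"]) (auto simp: unit_vec_def)
  then have unit: "vec_norm (unit_vec n j) = 1" by (simp add: vec_norm_def)
  have Ac: "A *\<^sub>v unit_vec n j \<in> carrier_vec m" by (rule mult_mat_vec_carrier[OF A uc])
  have "(A *\<^sub>v unit_vec n j) $ i = A $$ (i, j)"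
    using A \<open>i < m\<close> \<open>j < n\<close> by (simp add: scalar_prod_right_unit[where n = n])
  moreover have "cmod ((A *\<^sub>v unit_vec n j) $ i) \<le> vec_norm (A *\<^sub>v unit_vec n j)"
    unfolding vec_norm_eq_L2_set[OF Ac]
    by (rule member_le_L2_set[of "{..<m}" i "\<lambda>k. cmod ((A *\<^sub>v unit_vec n j) $ k)"]) (use \<open>i < m\<close> in auto)
  ultimately show ?thesis
    using vec_norm_mult_mat_vec_le[OF A uc] unit by simp
qed

lemma mat_dsum_carrier:
  assumes "A \<in> carrier_mat n n" "B \<in> carrier_mat m m"
  shows "mat_dsum A B \<in> carrier_mat (n + m) (n + m)"
  using assms unfolding mat_dsum_def by auto

text \<open>A direct sum acts separately on the two parts of a vector, whose squared norms add up.\<close>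

lemma op_norm_mat_dsum_le:
  assumes A: "A \<in> carrier_mat n n" and B: "B \<in> carrier_mat m m"
  shows "op_norm (mat_dsum A B) \<le> max (op_norm A) (op_norm B)"
proof (rule op_norm_le[OF mat_dsum_carrier[OF A B]])
  let ?c = "max (op_norm A) (op_norm B)"
  show c: "0 \<le> ?c" using op_norm_nonneg[of A] by linarith
  fix v :: "complex vec" assume v: "v \<in> carrier_vec (n + m)"
  define x y where "x = vec_first v n" and "y = vec_last v m"
  have x: "x \<in> carrier_vec n" and y: "y \<in> carrier_vec m" and v_eq: "v = x @\<^sub>v y"
    using v by (auto simp: x_def y_def)
  have "mat_dsum A B *\<^sub>v v = (A *\<^sub>v x) @\<^sub>v (B *\<^sub>v y)"
    unfolding v_eq mat_dsum_def using mult_mat_vec_split[OF A B x y] A B by simp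
  then have "(vec_norm (mat_dsum A B *\<^sub>v v))\<^sup>2 = (vec_norm (A *\<^sub>v x))\<^sup>2 + (vec_norm (B *\<^sub>v y))\<^sup>2"
    using vec_norm_append[OF mult_mat_vec_carrier[OF A x] mult_mat_vec_carrier[OF B y]] by simp
  also have "\<dots> \<le> (?c * vec_norm x)\<^sup>2 + (?c * vec_norm y)\<^sup>2"
  proof (intro add_mono power_mono vec_norm_nonneg)
    show "vec_norm (A *\<^sub>v x) \<le> ?c * vec_norm x"
      using vec_norm_mult_mat_vec_le[OF A x] mult_right_mono[of "op_norm A" ?c "vec_norm x"]
        vec_norm_nonneg[of x] by linarith
    show "vec_norm (B *\<^sub>v y) \<le> ?c * vec_norm y"
      using vec_norm_mult_mat_vec_le[OF B y] mult_right_mono[of "op_norm B" ?c "vec_norm y"]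
        vec_norm_nonneg[of y] by linarith
  qed
  also have "\<dots> = (?c * vec_norm v)\<^sup>2"
    unfolding v_eq power_mult_distrib vec_norm_append[OF x y] by (simp add: algebra_simps)
  finally show "vec_norm (mat_dsum A B *\<^sub>v v) \<le> ?c * vec_norm v"
    by (rule power2_le_imp_le) (use c vec_norm_nonneg[of v] in simp)
qed

lemma mat_adjoint_carrier: "A \<in> carrier_mat n n \<Longrightarrow> mat_adjoint A \<in> carrier_mat n n"
  unfolding mat_adjoint_def by auto

lemma mat_adjoint_index:
  fixes A :: "complex mat"
  assumes "A \<in> carrier_mat n n" "i < n" "j < n"
  shows "mat_adjoint A $$ (i, j) = cnj (A $$ (j, i))"
  using assms unfolding mat_adjoint_def by (simp add: mat_of_rows_index)

lemma mat_mult_vec_index_sum: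
  fixes A :: "complex mat"
  assumes "A \<in> carrier_mat n n" "v \<in> carrier_vec n" "i < n"
  shows "(A *\<^sub>v v) $ i = (\<Sum>j<n. A $$ (i, j) * v $ j)"
  using assms by (auto simp: scalar_prod_def lessThan_atLeast0 intro!: sum.cong)

lemma cscalar_prod_adjoint:
  fixes A :: "complex mat"
  assumes A: "A \<in> carrier_mat n n" and v: "v \<in> carrier_vec n"
  shows "(mat_adjoint A *\<^sub>v v) \<bullet>c v = cnj ((A *\<^sub>v v) \<bullet>c v)"
proof -
  have A': "mat_adjoint A \<in> carrier_mat n n" using A by (rule mat_adjoint_carrier)
  have "(mat_adjoint A *\<^sub>v v) \<bullet>c v = (\<Sum>i<n. \<Sum>j<n. cnj (A $$ (j, i)) * v $ j * cnj (v $ i))"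
    unfolding cscalar_prod_sum[OF mult_mat_vec_carrier[OF A' v] v]
    by (intro sum.cong refl)
      (simp add: mat_mult_vec_index_sum[OF A' v] mat_adjoint_index[OF A] sum_distrib_right)
  also have "\<dots> = (\<Sum>j<n. \<Sum>i<n. cnj (A $$ (j, i)) * v $ j * cnj (v $ i))" by (rule sum.swap)
  also have "\<dots> = cnj ((A *\<^sub>v v) \<bullet>c v)"
    unfolding cscalar_prod_sum[OF mult_mat_vec_carrier[OF A v] v] cnj_sum
    by (intro sum.cong refl)
      (simp add: mat_mult_vec_index_sum[OF A v] sum_distrib_right sum_distrib_left mult_ac)
  finally show ?thesis .
qed

text \<open>The quadratic form of \<open>re_part A\<close> is the real part of that of \<open>A\<close>.\<close>

lemma psd_re_part:
  assumes A: "A \<in> carrier_mat n n"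
    and accretive: "\<And>v. v \<in> carrier_vec n \<Longrightarrow> 0 \<le> Re ((A *\<^sub>v v) \<bullet>c v)"
  shows "psd (re_part A)"
proof -
  have A': "mat_adjoint A \<in> carrier_mat n n" using A by (rule mat_adjoint_carrier)
  have R: "re_part A \<in> carrier_mat n n" unfolding re_part_def using A A' by simp
  have "mat_adjoint (re_part A) = re_part A"
  proof (rule eq_matI)
    fix i j assume "i < dim_row (re_part A)" "j < dim_col (re_part A)"
    then have ij: "i < n" "j < n" using R by auto
    show "mat_adjoint (re_part A) $$ (i, j) = re_part A $$ (i, j)"
      unfolding mat_adjoint_index[OF R ij] unfolding re_part_def
      using ij A A' by (simp add: mat_adjoint_index[OF A])
  qed (use R mat_adjoint_carrier[OF R] in auto)
  moreover have "0 \<le> (re_part A *\<^sub>v v) \<bullet>c v" if v: "v \<in> carrier_vec n" for v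
  proof -
    have "re_part A *\<^sub>v v = (1 / 2) \<cdot>\<^sub>v (A *\<^sub>v v + mat_adjoint A *\<^sub>v v)"
      unfolding re_part_def using A A' v
      by (intro eq_vecI) (auto simp: add_scalar_prod_distrib[of _ n])
    moreover have "A *\<^sub>v v \<in> carrier_vec n" "mat_adjoint A *\<^sub>v v \<in> carrier_vec n"
      using mult_mat_vec_carrier[OF A v] mult_mat_vec_carrier[OF A' v] by auto
    moreover from this have "((1 / 2) \<cdot>\<^sub>v (A *\<^sub>v v + mat_adjoint A *\<^sub>v v)) \<bullet>c v
        = (1 / 2) * ((A *\<^sub>v v + mat_adjoint A *\<^sub>v v) \<bullet>c v)"
      using v by (intro smult_scalar_prod_distrib[of _ n]) auto
    ultimately have "(re_part A *\<^sub>v v) \<bullet>c v = (1 / 2) * ((A *\<^sub>v v) \<bullet>c v + cnj ((A *\<^sub>v v) \<bullet>c v))"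
      using v by (simp add: add_scalar_prod_distrib[of _ n] cscalar_prod_adjoint[OF A v, symmetric])
    also have "\<dots> = complex_of_real (Re ((A *\<^sub>v v) \<bullet>c v))" by (simp add: complex_add_cnj)
    finally show ?thesis using accretive[OF v] by (simp add: less_eq_complex_def)
  qed
  ultimately show ?thesis using R unfolding psd_def by auto
qed

section \<open>Inverse matrices\<close>

definition mutually_inverse :: "nat \<Rightarrow> complex mat \<Rightarrow> complex mat \<Rightarrow> bool" where
  "mutually_inverse n A B \<longleftrightarrow>
     A \<in> carrier_mat n n \<and> B \<in> carrier_mat n n \<and> A * B = 1\<^sub>m n \<and> B * A = 1\<^sub>m n"

lemma mutually_inverse_unique:
  assumes "mutually_inverse n A B" "mutually_inverse n A C"
  shows "B = C"
proof -
  have "B = B * (A * C)"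
    using assms right_mult_one_mat[of B n n] unfolding mutually_inverse_def by simp
  also have "\<dots> = (B * A) * C" using assms unfolding mutually_inverse_def by (metis assoc_mult_mat)
  finally show ?thesis
    using assms left_mult_one_mat[of C n n] unfolding mutually_inverse_def by simp
qed

lemma mutually_inverse_sym: "mutually_inverse n A B \<Longrightarrow> mutually_inverse n B A"
  unfolding mutually_inverse_def by simp

lemma mutually_inverse_mult:
  assumes AB: "mutually_inverse n A B" and CD: "mutually_inverse n C D"
  shows "mutually_inverse n (A * C) (D * B)"
proof -
  have carriers: "A \<in> carrier_mat n n" "B \<in> carrier_mat n n" "C \<in> carrier_mat n n" "D \<in> carrier_mat n n"
    and one: "A * B = 1\<^sub>m n" "B * A = 1\<^sub>m n" "C * D = 1\<^sub>m n" "D * C = 1\<^sub>m n"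
    using assms unfolding mutually_inverse_def by auto
  have "A * C * (D * B) = A * ((C * D) * B)" "D * B * (A * C) = D * ((B * A) * C)"
    using carriers by (simp_all add: assoc_mult_mat[of _ n n _ n _ n])
  then show ?thesis
    unfolding mutually_inverse_def one using carriers one
    by (auto intro!: mult_carrier_mat[of _ n n _ n])
qed

lemma mutually_inverse_mat_inverse:
  assumes "A \<in> carrier_mat n n" "mat_inverse A = Some B"
  shows "mutually_inverse n A B"
  using mat_inverse(2)[OF assms] assms unfolding mutually_inverse_def by simp

lemma mat_inverse_eq_Some:
  assumes "mutually_inverse n A B"
  shows "mat_inverse A = Some B"
proof (cases "mat_inverse A")
  case None
  have A: "A \<in> carrier_mat n n" using assms unfolding mutually_inverse_def by simp
  have "A \<in> Units (ring_mat TYPE(complex) n ())"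
    using assms unfolding mutually_inverse_def Units_def ring_mat_def by auto
  then show ?thesis using mat_inverse(1)[OF A None, of "()"] by contradiction
next
  case (Some C)
  then show ?thesis
    using mutually_inverse_mat_inverse[of A n C] mutually_inverse_unique[OF assms] assms
    unfolding mutually_inverse_def by auto
qed

lemma mutually_inverse_det_nonzero:
  assumes "mutually_inverse n A B"
  shows "Determinant.det A \<noteq> 0"
  using assms det_mult[of A n B] unfolding mutually_inverse_def by auto

text \<open>A square matrix that is bounded below has trivial kernel, and the lower bound turns into an upper bound for
  the inverse.\<close>

lemma bounded_below_imp_inverse:
  assumes A: "A \<in> carrier_mat n n" and c: "0 < c"
    and below: "\<And>v. v \<in> carrier_vec n \<Longrightarrow> c * vec_norm v \<le> vec_norm (A *\<^sub>v v)"
  obtains B where "mutually_inverse n A B" "op_norm B \<le> 1 / c"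
proof -
  have "Determinant.det A \<noteq> 0"
  proof
    assume "Determinant.det A = 0"
    then obtain v where v: "v \<in> carrier_vec n" "v \<noteq> 0\<^sub>v n" "A *\<^sub>v v = 0\<^sub>v n"
      using det_0_iff_vec_prod_zero[OF A] by auto
    then have "c * vec_norm v \<le> 0" using below[OF v(1)] by simp
    then have "vec_norm v = 0" using c vec_norm_nonneg[of v] by (simp add: mult_le_0_iff)
    then show False using v vec_norm_eq_0_iff by auto
  qed
  then have "A \<in> Units (ring_mat TYPE(complex) n ())" by (rule det_non_zero_imp_unit[OF A])
  then obtain B where B: "mutually_inverse n A B"
    using mat_inverse(1)[OF A, of "()"] mutually_inverse_mat_inverse[OF A] that
    by (cases "mat_inverse A") auto
  have "op_norm B \<le> 1 / c"
  proof (rule op_norm_le)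
    show Bc: "B \<in> carrier_mat n n" using B unfolding mutually_inverse_def by simp
    show "0 \<le> 1 / c" using c by simp
    fix v :: "complex vec" assume v: "v \<in> carrier_vec n"
    have "A *\<^sub>v (B *\<^sub>v v) = v"
      using B v assoc_mult_mat_vec[OF A Bc v] unfolding mutually_inverse_def by simp
    then show "vec_norm (B *\<^sub>v v) \<le> 1 / c * vec_norm v"
      using below[OF mult_mat_vec_carrier[OF Bc v]] c by (simp add: field_simps)
  qed
  then show thesis using B that by blast
qed

section \<open>NC functions on the bidisk\<close>

lemma bidisk_levelD:
  assumes "P \<in> bidisk_level n"
  shows "P \<in> bidisk" "fst P \<in> carrier_mat n n" "snd P \<in> carrier_mat n n" "1 \<le> n"
    "op_norm (fst P) < 1" "op_norm (snd P) < 1"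
  using assms unfolding bidisk_level_def bidisk_def nc_points_def by auto

lemma bidisk_levelI:
  assumes "X \<in> carrier_mat n n" "Y \<in> carrier_mat n n" "1 \<le> n" "op_norm X < 1" "op_norm Y < 1"
  shows "(X, Y) \<in> bidisk_level n"
  using assms unfolding bidisk_level_def bidisk_def nc_points_def by auto

lemma bidisk_obtain_level:
  assumes "P \<in> bidisk"
  obtains n where "P \<in> bidisk_level n"
  using assms unfolding bidisk_level_def bidisk_def nc_points_def by blast

lemma bidisk_dsum:
  assumes "(X1, X2) \<in> bidisk_level n" "(Y1, Y2) \<in> bidisk_level m"
  shows "(mat_dsum X1 Y1, mat_dsum X2 Y2) \<in> bidisk_level (n + m)"
proof -
  note X = bidisk_levelD[OF assms(1), simplified] and Y = bidisk_levelD[OF assms(2), simplified]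
  show ?thesis
    using op_norm_mat_dsum_le[OF X(2) Y(2)] op_norm_mat_dsum_le[OF X(3) Y(3)] X Y
    by (intro bidisk_levelI mat_dsum_carrier) auto
qed

lemma op_norm_zero_mat: "op_norm (0\<^sub>m n n) = 0"
proof (rule antisym)
  have "0\<^sub>m n n *\<^sub>v v = 0\<^sub>v n" if "v \<in> carrier_vec n" for v :: "complex vec"
    using that by (intro eq_vecI) auto
  then show "op_norm (0\<^sub>m n n) \<le> 0" by (intro op_norm_le[of _ n n]) auto
qed (rule op_norm_nonneg)

lemma bidisk_nonempty: "bidisk \<noteq> {}"
proof -
  have "(0\<^sub>m 1 1, 0\<^sub>m 1 1) \<in> bidisk_level 1"
    by (rule bidisk_levelI) (auto simp: op_norm_zero_mat simp del: One_nat_def)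
  then show ?thesis using bidisk_levelD(1) by blast
qed

lemma mat_dsum_mult:
  assumes "A \<in> carrier_mat n n" "B \<in> carrier_mat m m" "C \<in> carrier_mat n n" "D \<in> carrier_mat m m"
  shows "mat_dsum A B * mat_dsum C D = mat_dsum (A * C) (B * D)"
  using assms unfolding mat_dsum_def by (subst mult_four_block_mat[of _ n n _ m _ m]) auto

lemma mat_dsum_lincomb:
  fixes A B C D :: "complex mat"
  assumes "A \<in> carrier_mat n n" "B \<in> carrier_mat m m" "C \<in> carrier_mat n n" "D \<in> carrier_mat m m"
  shows "a \<cdot>\<^sub>m mat_dsum A B + b \<cdot>\<^sub>m mat_dsum C D = mat_dsum (a \<cdot>\<^sub>m A + b \<cdot>\<^sub>m C) (a \<cdot>\<^sub>m B + b \<cdot>\<^sub>m D)"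
  using assms unfolding mat_dsum_def by (intro eq_matI) auto

lemma mat_dsum_one: "mat_dsum (1\<^sub>m n) (1\<^sub>m m) = 1\<^sub>m (n + m)"
  unfolding mat_dsum_def by (intro eq_matI) auto

lemma conjugation_mult:
  assumes ST: "mutually_inverse n S T" and A: "A \<in> carrier_mat n n" and B: "B \<in> carrier_mat n n"
  shows "(T * A * S) * (T * B * S) = T * (A * B) * S"
proof -
  have S: "S \<in> carrier_mat n n" and T: "T \<in> carrier_mat n n" and one: "S * T = 1\<^sub>m n"
    using ST unfolding mutually_inverse_def by auto
  have "(T * A * S) * (T * B * S) = T * A * (S * (T * (B * S)))"
    using S T A B by (simp add: assoc_mult_mat[of _ n n _ n _ n])
  also have "S * (T * (B * S)) = (S * T) * (B * S)"
    using S T B by (simp add: assoc_mult_mat[of _ n n _ n _ n])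
  also have "\<dots> = B * S" using B S unfolding one by simp
  also have "T * A * (B * S) = T * (A * B) * S"
    using S T A B by (simp add: assoc_mult_mat[of _ n n _ n _ n])
  finally show ?thesis .
qed

lemma conjugation_lincomb:
  fixes A B S T :: "complex mat"
  assumes "S \<in> carrier_mat n n" "T \<in> carrier_mat n n" "A \<in> carrier_mat n n" "B \<in> carrier_mat n n"
  shows "T * (a \<cdot>\<^sub>m A + b \<cdot>\<^sub>m B) * S = a \<cdot>\<^sub>m (T * A * S) + b \<cdot>\<^sub>m (T * B * S)"
  using assms
  by (simp add: mult_add_distrib_mat[of _ n n _ n] add_mult_distrib_mat[of _ n n _ _ n]
      mult_smult_distrib[of _ n n _ n] mult_smult_assoc_mat[of _ n n _ n])

lemma conjugation_one:
  assumes "mutually_inverse n S T"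
  shows "T * 1\<^sub>m n * S = 1\<^sub>m n"
  using assms right_mult_one_mat[of T n n] unfolding mutually_inverse_def by simp

lemma mutually_inverse_conjugation:
  assumes ST: "mutually_inverse n S T" and AB: "mutually_inverse n A B"
  shows "mutually_inverse n (T * A * S) (T * B * S)"
  using conjugation_mult[OF ST, of A B] conjugation_mult[OF ST, of B A] conjugation_one[OF ST] ST AB
  unfolding mutually_inverse_def by (auto intro!: mult_carrier_mat[of _ n n _ n])

lemma mutually_inverse_dsum:
  assumes "mutually_inverse n A B" "mutually_inverse m C D"
  shows "mutually_inverse (n + m) (mat_dsum A C) (mat_dsum B D)"
  using assms mat_dsum_mult[of A n C m B D] mat_dsum_mult[of B n D m A C] mat_dsum_one[of n m]
    mat_dsum_carrier
  unfolding mutually_inverse_def by simp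

lemma nc_functionI:
  assumes "\<And>n P. P \<in> bidisk_level n \<Longrightarrow> F P \<in> carrier_mat n n"
    and "\<And>n m X1 X2 Y1 Y2. (X1, X2) \<in> bidisk_level n \<Longrightarrow> (Y1, Y2) \<in> bidisk_level m \<Longrightarrow>
      F (mat_dsum X1 Y1, mat_dsum X2 Y2) = mat_dsum (F (X1, X2)) (F (Y1, Y2))"
    and "\<And>n X Y S T. (X, Y) \<in> bidisk_level n \<Longrightarrow> mutually_inverse n S T \<Longrightarrow>
      (T * X * S, T * Y * S) \<in> bidisk_level n \<Longrightarrow> F (T * X * S, T * Y * S) = T * F (X, Y) * S"
  shows "nc_function F"
  unfolding nc_function_def
proof (intro conjI allI ballI, goal_cases)
  case (1 n P) then show ?case by (rule assms(1))
next
  case (2 P)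
  then show ?case using assms(2) by (auto elim!: bidisk_obtain_level)
next
  case (3 n P)
  then show ?case using assms(3) by (auto simp: mutually_inverse_def inverts_mat_def)
qed

lemma nc_function_carrier:
  assumes "nc_function F" "P \<in> bidisk_level n"
  shows "F P \<in> carrier_mat n n"
  using assms unfolding nc_function_def by blast

lemma nc_function_dsum:
  assumes "nc_function F" "(X1, X2) \<in> bidisk_level n" "(Y1, Y2) \<in> bidisk_level m"
  shows "F (mat_dsum X1 Y1, mat_dsum X2 Y2) = mat_dsum (F (X1, X2)) (F (Y1, Y2))"
proof -
  have "\<forall>(X1, X2) \<in> bidisk. \<forall>(Y1, Y2) \<in> bidisk.
      F (mat_dsum X1 Y1, mat_dsum X2 Y2) = mat_dsum (F (X1, X2)) (F (Y1, Y2))"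
    using assms(1) unfolding nc_function_def by blast
  then show ?thesis using bidisk_levelD(1)[OF assms(2)] bidisk_levelD(1)[OF assms(3)] by blast
qed

lemma nc_function_similarity:
  assumes "nc_function F" "(X, Y) \<in> bidisk_level n" "mutually_inverse n S T"
    "(T * X * S, T * Y * S) \<in> bidisk_level n"
  shows "F (T * X * S, T * Y * S) = T * F (X, Y) * S"
proof -
  have S: "S \<in> carrier_mat n n" and T: "T \<in> carrier_mat n n" and "inverts_mat S T" "inverts_mat T S"
    using assms(3) unfolding mutually_inverse_def inverts_mat_def by auto
  moreover have "\<forall>(X, Y) \<in> bidisk_level n. \<forall>S \<in> carrier_mat n n. \<forall>T \<in> carrier_mat n n.
        inverts_mat S T \<and> inverts_mat T S \<and> (T * X * S, T * Y * S) \<in> bidisk_level n \<longrightarrow>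
        F (T * X * S, T * Y * S) = T * F (X, Y) * S"
    using assms(1) unfolding nc_function_def by blast
  ultimately show ?thesis using assms(2,4) by blast
qed

lemma nc_function_cong:
  assumes F: "nc_function F" and eq: "\<And>P. P \<in> bidisk \<Longrightarrow> F P = G P"
  shows "nc_function G"
proof (rule nc_functionI)
  show "G P \<in> carrier_mat n n" if "P \<in> bidisk_level n" for n P
    using nc_function_carrier[OF F that] eq[OF bidisk_levelD(1)[OF that]] by simp
next
  fix n m X1 X2 Y1 Y2 assume X: "(X1, X2) \<in> bidisk_level n" and Y: "(Y1, Y2) \<in> bidisk_level m"
  show "G (mat_dsum X1 Y1, mat_dsum X2 Y2) = mat_dsum (G (X1, X2)) (G (Y1, Y2))"
    using nc_function_dsum[OF F X Y] eq[OF bidisk_levelD(1)[OF X]] eq[OF bidisk_levelD(1)[OF Y]]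
      eq[OF bidisk_levelD(1)[OF bidisk_dsum[OF X Y]]] by simp
next
  fix n X Y S T assume X: "(X, Y) \<in> bidisk_level n" and ST: "mutually_inverse n S T"
    and X': "(T * X * S, T * Y * S) \<in> bidisk_level n"
  show "G (T * X * S, T * Y * S) = T * G (X, Y) * S"
    using nc_function_similarity[OF F X ST X'] eq[OF bidisk_levelD(1)[OF X]]
      eq[OF bidisk_levelD(1)[OF X']] by simp
qed

lemma nc_function_fst: "nc_function fst"
  by (rule nc_functionI) (auto dest: bidisk_levelD)

lemma nc_function_snd: "nc_function snd"
  by (rule nc_functionI) (auto dest: bidisk_levelD)

lemma nc_function_one: "nc_function (\<lambda>P. 1\<^sub>m (dim_row (fst P)))"
proof (rule nc_functionI)
  show "1\<^sub>m (dim_row (fst P)) \<in> carrier_mat n n" if "P \<in> bidisk_level n" for n and P :: mat_pair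
    using bidisk_levelD(2)[OF that] by simp
next
  fix n m X1 X2 Y1 Y2 assume "(X1, X2) \<in> bidisk_level n" "(Y1, Y2) \<in> bidisk_level m"
  then have "X1 \<in> carrier_mat n n" "Y1 \<in> carrier_mat m m" by (auto dest: bidisk_levelD)
  then show "1\<^sub>m (dim_row (fst (mat_dsum X1 Y1, mat_dsum X2 Y2)))
      = mat_dsum (1\<^sub>m (dim_row (fst (X1, X2)))) (1\<^sub>m (dim_row (fst (Y1, Y2))))"
    using mat_dsum_carrier[of X1 n Y1 m] mat_dsum_one[of n m] by simp
next
  fix n X Y S T assume "(X, Y) \<in> bidisk_level n" and ST: "mutually_inverse n S T"
  then have "X \<in> carrier_mat n n" by (auto dest: bidisk_levelD)
  then show "1\<^sub>m (dim_row (fst (T * X * S, T * Y * S))) = T * 1\<^sub>m (dim_row (fst (X, Y))) * S"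
    using conjugation_one[OF ST] ST carrier_matD(1)[of T n n] unfolding mutually_inverse_def by simp
qed

lemma nc_function_lincomb:
  assumes F: "nc_function F" and G: "nc_function G"
  shows "nc_function (\<lambda>P. a \<cdot>\<^sub>m F P + b \<cdot>\<^sub>m G P)"
proof (rule nc_functionI)
  show "a \<cdot>\<^sub>m F P + b \<cdot>\<^sub>m G P \<in> carrier_mat n n" if "P \<in> bidisk_level n" for n P
    using nc_function_carrier[OF F that] nc_function_carrier[OF G that] by simp
next
  fix n m X1 X2 Y1 Y2 assume X: "(X1, X2) \<in> bidisk_level n" and Y: "(Y1, Y2) \<in> bidisk_level m"
  show "a \<cdot>\<^sub>m F (mat_dsum X1 Y1, mat_dsum X2 Y2) + b \<cdot>\<^sub>m G (mat_dsum X1 Y1, mat_dsum X2 Y2)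
      = mat_dsum (a \<cdot>\<^sub>m F (X1, X2) + b \<cdot>\<^sub>m G (X1, X2)) (a \<cdot>\<^sub>m F (Y1, Y2) + b \<cdot>\<^sub>m G (Y1, Y2))"
    unfolding nc_function_dsum[OF F X Y] nc_function_dsum[OF G X Y]
    by (rule mat_dsum_lincomb) (use F G X Y in \<open>auto intro: nc_function_carrier\<close>)
next
  fix n X Y S T assume X: "(X, Y) \<in> bidisk_level n" and ST: "mutually_inverse n S T"
    and X': "(T * X * S, T * Y * S) \<in> bidisk_level n"
  show "a \<cdot>\<^sub>m F (T * X * S, T * Y * S) + b \<cdot>\<^sub>m G (T * X * S, T * Y * S)
      = T * (a \<cdot>\<^sub>m F (X, Y) + b \<cdot>\<^sub>m G (X, Y)) * S"
    unfolding nc_function_similarity[OF F X ST X'] nc_function_similarity[OF G X ST X']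
    by (rule conjugation_lincomb[symmetric, of _ n])
      (use F G X ST in \<open>auto intro: nc_function_carrier simp: mutually_inverse_def\<close>)
qed

lemma nc_function_mult:
  assumes F: "nc_function F" and G: "nc_function G"
  shows "nc_function (\<lambda>P. F P * G P)"
proof (rule nc_functionI)
  show "F P * G P \<in> carrier_mat n n" if "P \<in> bidisk_level n" for n P
    using nc_function_carrier[OF F that] nc_function_carrier[OF G that] by simp
next
  fix n m X1 X2 Y1 Y2 assume X: "(X1, X2) \<in> bidisk_level n" and Y: "(Y1, Y2) \<in> bidisk_level m"
  show "F (mat_dsum X1 Y1, mat_dsum X2 Y2) * G (mat_dsum X1 Y1, mat_dsum X2 Y2)
      = mat_dsum (F (X1, X2) * G (X1, X2)) (F (Y1, Y2) * G (Y1, Y2))"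
    unfolding nc_function_dsum[OF F X Y] nc_function_dsum[OF G X Y]
    by (rule mat_dsum_mult) (use F G X Y in \<open>auto intro: nc_function_carrier\<close>)
next
  fix n X Y S T assume X: "(X, Y) \<in> bidisk_level n" and ST: "mutually_inverse n S T"
    and X': "(T * X * S, T * Y * S) \<in> bidisk_level n"
  show "F (T * X * S, T * Y * S) * G (T * X * S, T * Y * S) = T * (F (X, Y) * G (X, Y)) * S"
    unfolding nc_function_similarity[OF F X ST X'] nc_function_similarity[OF G X ST X']
    by (rule conjugation_mult[OF ST]) (use F G X in \<open>auto intro: nc_function_carrier\<close>)
qed

text \<open>The inverse inherits the NC identities from \<open>F\<close> because inverses of matrices are unique. Boundedness is
  kept apart from these closure properties: \<open>(1 - X)\<^sup>-\<^sup>1\<close>, out of which the parallel sum is built, is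
  unbounded on the bidisk.\<close>

lemma nc_function_inverse:
  assumes F: "nc_function F"
    and inv: "\<And>n P. P \<in> bidisk_level n \<Longrightarrow> mutually_inverse n (F P) (G P)"
  shows "nc_function G"
proof (rule nc_functionI)
  show "G P \<in> carrier_mat n n" if "P \<in> bidisk_level n" for n P
    using inv[OF that] unfolding mutually_inverse_def by simp
next
  fix n m X1 X2 Y1 Y2 assume X: "(X1, X2) \<in> bidisk_level n" and Y: "(Y1, Y2) \<in> bidisk_level m"
  show "G (mat_dsum X1 Y1, mat_dsum X2 Y2) = mat_dsum (G (X1, X2)) (G (Y1, Y2))"
    using mutually_inverse_unique[OF inv[OF bidisk_dsum[OF X Y]]]
      mutually_inverse_dsum[OF inv[OF X] inv[OF Y]] nc_function_dsum[OF F X Y] by simp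
next
  fix n X Y S T assume X: "(X, Y) \<in> bidisk_level n" and ST: "mutually_inverse n S T"
    and X': "(T * X * S, T * Y * S) \<in> bidisk_level n"
  show "G (T * X * S, T * Y * S) = T * G (X, Y) * S"
    using mutually_inverse_unique[OF inv[OF X']] mutually_inverse_conjugation[OF ST inv[OF X]]
      nc_function_similarity[OF F X ST X'] by simp
qed

section \<open>The algebra of bounded NC functions\<close>

lemma hinfI:
  assumes "nc_function F" "\<And>P. P \<in> bidisk \<Longrightarrow> op_norm (F P) \<le> C"
  shows "restrict F bidisk \<in> hinf"
  unfolding hinf_def
  using nc_function_cong[OF assms(1), of "restrict F bidisk"] assms(2)
  by (auto intro!: bdd_aboveI2)

lemma hinf_nc_function: "F \<in> hinf \<Longrightarrow> nc_function F"
  unfolding hinf_def by simp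

lemma hinf_carrier: "F \<in> hinf \<Longrightarrow> P \<in> bidisk_level n \<Longrightarrow> F P \<in> carrier_mat n n"
  using hinf_nc_function nc_function_carrier by blast

lemma op_norm_le_hinf_norm:
  assumes "F \<in> hinf" "P \<in> bidisk"
  shows "op_norm (F P) \<le> hinf_norm F"
  using assms unfolding hinf_norm_def hinf_def by (auto intro: cSUP_upper)

lemma hinf_norm_le: "(\<And>P. P \<in> bidisk \<Longrightarrow> op_norm (F P) \<le> C) \<Longrightarrow> hinf_norm F \<le> C"
  unfolding hinf_norm_def by (rule cSUP_least[OF bidisk_nonempty])

lemma hinf_norm_nonneg: "F \<in> hinf \<Longrightarrow> 0 \<le> hinf_norm F"
  using op_norm_le_hinf_norm op_norm_nonneg bidisk_nonempty order_trans by blast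

lemma op_norm_lincomb_hinf_le:
  assumes F: "F \<in> hinf" and G: "G \<in> hinf" and P: "P \<in> bidisk"
  shows "op_norm (a \<cdot>\<^sub>m F P + b \<cdot>\<^sub>m G P) \<le> cmod a * hinf_norm F + cmod b * hinf_norm G"
proof -
  obtain n where n: "P \<in> bidisk_level n" using P by (rule bidisk_obtain_level)
  have "op_norm (a \<cdot>\<^sub>m F P + b \<cdot>\<^sub>m G P) \<le> cmod a * op_norm (F P) + cmod b * op_norm (G P)"
    by (rule op_norm_lincomb_le[OF hinf_carrier[OF F n] hinf_carrier[OF G n]])
  also have "\<dots> \<le> cmod a * hinf_norm F + cmod b * hinf_norm G"
    by (intro add_mono mult_left_mono op_norm_le_hinf_norm F G P) auto
  finally show ?thesis .
qed

lemma op_norm_mult_hinf_le: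
  assumes F: "F \<in> hinf" and G: "G \<in> hinf" and P: "P \<in> bidisk"
  shows "op_norm (F P * G P) \<le> hinf_norm F * hinf_norm G"
proof -
  obtain n where n: "P \<in> bidisk_level n" using P by (rule bidisk_obtain_level)
  have "op_norm (F P * G P) \<le> op_norm (F P) * op_norm (G P)"
    by (rule op_norm_mult_le[OF hinf_carrier[OF F n] hinf_carrier[OF G n]])
  also have "\<dots> \<le> hinf_norm F * hinf_norm G"
    by (intro mult_mono op_norm_le_hinf_norm F G P op_norm_nonneg hinf_norm_nonneg)
  finally show ?thesis .
qed

lemma lincomb_in_hinf:
  assumes "F \<in> hinf" "G \<in> hinf"
  shows "(\<lambda>P \<in> bidisk. a \<cdot>\<^sub>m F P + b \<cdot>\<^sub>m G P) \<in> hinf"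
  by (rule hinfI[OF nc_function_lincomb op_norm_lincomb_hinf_le[OF assms]])
    (use assms in \<open>auto intro: hinf_nc_function\<close>)

lemma hinf_mult_in_hinf:
  assumes "F \<in> hinf" "G \<in> hinf"
  shows "hinf_mult F G \<in> hinf"
  unfolding hinf_mult_def
  by (rule hinfI[OF nc_function_mult op_norm_mult_hinf_le[OF assms]])
    (use assms in \<open>auto intro: hinf_nc_function\<close>)

lemma zero_in_hinf: "(\<lambda>P \<in> bidisk. 0\<^sub>m (dim_row (fst P)) (dim_row (fst P))) \<in> hinf"
proof (rule hinfI)
  show "op_norm (0\<^sub>m (dim_row (fst P)) (dim_row (fst P))) \<le> 0" for P :: mat_pair
    by (simp add: op_norm_zero_mat)
  show "nc_function (\<lambda>P. 0\<^sub>m (dim_row (fst P)) (dim_row (fst P)))"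
    by (rule nc_function_cong[OF nc_function_lincomb[OF nc_function_one nc_function_one, of 0 0]])
      (auto intro!: eq_matI)
qed

section \<open>Weak-* convergence of bounded sequences\<close>

text \<open>A functional on matrices is determined by its values on matrix units, hence it is continuous
  for the entrywise convergence and for the operator norm.\<close>

lemma mat_functional_sum:
  assumes \<eta>: "\<eta> \<in> mat_functionals n"
  obtains c where "\<And>A. A \<in> carrier_mat n n \<Longrightarrow> \<eta> A = (\<Sum>p \<in> {..<n} \<times> {..<n}. A $$ p * c p)"
proof -
  define U where "U q = mat n n (\<lambda>p. if p = q then 1 else 0 :: complex)" for q
  have lin: "\<eta> (a \<cdot>\<^sub>m A + b \<cdot>\<^sub>m B) = a * \<eta> A + b * \<eta> B"
    if "A \<in> carrier_mat n n" "B \<in> carrier_mat n n" for A B a b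
    using \<eta> that unfolding mat_functionals_def by blast
  have "\<eta> (0 \<cdot>\<^sub>m 0\<^sub>m n n + 0 \<cdot>\<^sub>m 0\<^sub>m n n) = 0" by (subst lin) auto
  moreover have "0 \<cdot>\<^sub>m 0\<^sub>m n n + 0 \<cdot>\<^sub>m 0\<^sub>m n n = (0\<^sub>m n n :: complex mat)" by (intro eq_matI) auto
  ultimately have zero: "\<eta> (0\<^sub>m n n) = 0" by simp
  have expand: "\<eta> (mat n n (\<lambda>p. if p \<in> I then f p else 0)) = (\<Sum>q \<in> I. f q * \<eta> (U q))"
    if "finite I" for I and f :: "nat \<times> nat \<Rightarrow> complex"
    using that
  proof (induction I)
    case empty
    have "mat n n (\<lambda>p. 0) = (0\<^sub>m n n :: complex mat)" by (intro eq_matI) auto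
    then show ?case using zero by simp
  next
    case (insert q I)
    have "mat n n (\<lambda>p. if p \<in> insert q I then f p else 0)
        = f q \<cdot>\<^sub>m U q + 1 \<cdot>\<^sub>m mat n n (\<lambda>p. if p \<in> I then f p else 0)"
      using insert.hyps by (intro eq_matI) (auto simp: U_def)
    then show ?case using insert by (simp add: lin U_def)
  qed
  show thesis
  proof (rule that)
    fix A :: "complex mat" assume A: "A \<in> carrier_mat n n"
    then have "A = mat n n (\<lambda>p. if p \<in> {..<n} \<times> {..<n} then A $$ p else 0)"
      by (intro eq_matI) auto
    then show "\<eta> A = (\<Sum>p \<in> {..<n} \<times> {..<n}. A $$ p * \<eta> (U p))"
      using expand[of "{..<n} \<times> {..<n}" "\<lambda>p. A $$ p"] by simp
  qed
qed

text \<open>Membership in \<^const>\<open>hinf_dual\<close> without extensionality, so that pointwise sums and differences of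
  functionals, as they occur in \<^const>\<open>predual\<close>, stay in the class.\<close>

definition bounded_functional :: "((mat_pair \<Rightarrow> complex mat) \<Rightarrow> complex) \<Rightarrow> bool" where
  "bounded_functional \<phi> \<longleftrightarrow>
     (\<forall>F \<in> hinf. \<forall>G \<in> hinf. \<forall>a b.
        \<phi> (\<lambda>P \<in> bidisk. a \<cdot>\<^sub>m F P + b \<cdot>\<^sub>m G P) = a * \<phi> F + b * \<phi> G) \<and>
     (\<exists>C. \<forall>F \<in> hinf. cmod (\<phi> F) \<le> C * hinf_norm F)"

lemma bounded_functional_lincomb:
  assumes "bounded_functional \<phi>" "F \<in> hinf" "G \<in> hinf"
  shows "\<phi> (\<lambda>P \<in> bidisk. a \<cdot>\<^sub>m F P + b \<cdot>\<^sub>m G P) = a * \<phi> F + b * \<phi> G"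
  using assms unfolding bounded_functional_def by blast

lemma bounded_functional_combine:
  assumes \<phi>: "bounded_functional \<phi>" and \<psi>: "bounded_functional \<psi>"
  shows "bounded_functional (\<lambda>F. c * \<phi> F + d * \<psi> F)"
proof -
  obtain C D where C: "\<forall>F \<in> hinf. cmod (\<phi> F) \<le> C * hinf_norm F"
    and D: "\<forall>F \<in> hinf. cmod (\<psi> F) \<le> D * hinf_norm F"
    using assms unfolding bounded_functional_def by blast
  have "cmod (c * \<phi> F + d * \<psi> F) \<le> (cmod c * C + cmod d * D) * hinf_norm F" if F: "F \<in> hinf" for F
  proof -
    have "cmod (c * \<phi> F + d * \<psi> F) \<le> cmod c * cmod (\<phi> F) + cmod d * cmod (\<psi> F)"
      by (rule order_trans[OF norm_triangle_ineq]) (simp add: norm_mult)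
    also have "\<dots> \<le> cmod c * (C * hinf_norm F) + cmod d * (D * hinf_norm F)"
      using C D F by (intro add_mono mult_left_mono) auto
    finally show ?thesis by (simp add: algebra_simps)
  qed
  moreover have "c * \<phi> (\<lambda>P \<in> bidisk. a \<cdot>\<^sub>m F P + b \<cdot>\<^sub>m G P) + d * \<psi> (\<lambda>P \<in> bidisk. a \<cdot>\<^sub>m F P + b \<cdot>\<^sub>m G P)
      = a * (c * \<phi> F + d * \<psi> F) + b * (c * \<phi> G + d * \<psi> G)"
    if "F \<in> hinf" "G \<in> hinf" for F G a b
    unfolding bounded_functional_lincomb[OF \<phi> that] bounded_functional_lincomb[OF \<psi> that]
    by (simp add: algebra_simps)
  ultimately show ?thesis unfolding bounded_functional_def by blast
qed

lemma bounded_functional_sum: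
  assumes "finite A" "\<And>\<phi>. \<phi> \<in> A \<Longrightarrow> bounded_functional \<phi>"
  shows "bounded_functional (\<lambda>F. \<Sum>\<phi> \<in> A. c \<phi> * \<phi> F)"
  using assms
proof (induction A)
  case empty
  show ?case unfolding bounded_functional_def by (auto intro: exI[of _ 0])
next
  case (insert \<phi> A)
  then show ?case
    using bounded_functional_combine[of \<phi> "\<lambda>F. \<Sum>\<phi> \<in> A. c \<phi> * \<phi> F" "c \<phi>" 1] by simp
qed

lemma bounded_functional_cong:
  assumes "bounded_functional \<phi>" "\<And>F. F \<in> hinf \<Longrightarrow> \<phi> F = \<psi> F"
  shows "bounded_functional \<psi>"
  using assms(1) lincomb_in_hinf unfolding bounded_functional_def by (simp add: assms(2))

lemma bounded_functional_point:
  assumes "\<phi> \<in> point_functionals"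
  shows "bounded_functional \<phi>"
proof -
  obtain n P \<eta> where P: "P \<in> bidisk_level n" and \<eta>: "\<eta> \<in> mat_functionals n"
    and \<phi>: "\<phi> = (\<lambda>F \<in> hinf. \<eta> (F P))"
    using assms unfolding point_functionals_def by blast
  obtain c where c: "\<And>A. A \<in> carrier_mat n n \<Longrightarrow> \<eta> A = (\<Sum>p \<in> {..<n} \<times> {..<n}. A $$ p * c p)"
    using mat_functional_sum[OF \<eta>] by blast
  have "cmod (\<eta> (F P)) \<le> (\<Sum>p \<in> {..<n} \<times> {..<n}. cmod (c p)) * hinf_norm F" if F: "F \<in> hinf" for F
  proof -
    have "cmod (\<eta> (F P)) \<le> (\<Sum>p \<in> {..<n} \<times> {..<n}. cmod (c p) * hinf_norm F)"
      unfolding c[OF hinf_carrier[OF F P]]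
    proof (rule sum_norm_le)
      fix p assume "p \<in> {..<n} \<times> {..<n}"
      then have "cmod (F P $$ p) \<le> hinf_norm F"
        using entry_le_op_norm[OF hinf_carrier[OF F P]] op_norm_le_hinf_norm[OF F bidisk_levelD(1)[OF P]]
        by (cases p) (auto intro: order_trans)
      then show "cmod (F P $$ p * c p) \<le> cmod (c p) * hinf_norm F"
        using mult_right_mono[of "cmod (F P $$ p)" "hinf_norm F" "cmod (c p)"]
        by (simp add: norm_mult mult.commute)
    qed
    then show ?thesis by (simp add: sum_distrib_right)
  qed
  moreover have "\<eta> (a \<cdot>\<^sub>m F P + b \<cdot>\<^sub>m G P) = a * \<eta> (F P) + b * \<eta> (G P)"
    if "F \<in> hinf" "G \<in> hinf" for F G a b
    using \<eta> hinf_carrier[OF that(1) P] hinf_carrier[OF that(2) P] unfolding mat_functionals_def by blast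
  ultimately have "bounded_functional (\<lambda>F. \<eta> (F P))"
    using bidisk_levelD(1)[OF P] unfolding bounded_functional_def by auto
  then show ?thesis unfolding \<phi> by (rule bounded_functional_cong) simp
qed

lemma point_spanE:
  assumes "\<psi> \<in> point_span"
  obtains A c where "finite A" "A \<subseteq> point_functionals" "\<psi> = (\<lambda>F \<in> hinf. \<Sum>\<phi> \<in> A. c \<phi> * \<phi> F)"
  using assms unfolding point_span_def by blast

lemma bounded_functional_point_span:
  assumes "\<psi> \<in> point_span"
  shows "bounded_functional \<psi>"
proof -
  obtain A c where A: "finite A" "A \<subseteq> point_functionals"
    and \<psi>: "\<psi> = (\<lambda>F \<in> hinf. \<Sum>\<phi> \<in> A. c \<phi> * \<phi> F)"
    using assms by (rule point_spanE)
  have "bounded_functional (\<lambda>F. \<Sum>\<phi> \<in> A. c \<phi> * \<phi> F)"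
    using A bounded_functional_point by (intro bounded_functional_sum) auto
  then show ?thesis unfolding \<psi> by (rule bounded_functional_cong) simp
qed

text \<open>Boundedness of \<open>\<chi>\<close> is what makes the supremum in \<^const>\<open>dual_norm\<close> an upper bound.\<close>

lemma cmod_le_dual_norm:
  assumes \<chi>: "bounded_functional \<chi>" and F: "F \<in> hinf" and F1: "hinf_norm F \<le> 1"
  shows "cmod (\<chi> F) \<le> dual_norm \<chi>"
proof -
  obtain C where C: "\<And>F. F \<in> hinf \<Longrightarrow> cmod (\<chi> F) \<le> C * hinf_norm F"
    using \<chi> unfolding bounded_functional_def by blast
  have "cmod (\<chi> G) \<le> \<bar>C\<bar>" if "G \<in> {F \<in> hinf. hinf_norm F \<le> 1}" for G
  proof -
    have "cmod (\<chi> G) \<le> C * hinf_norm G" using C that by blast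
    also have "\<dots> \<le> \<bar>C\<bar> * hinf_norm G" using hinf_norm_nonneg that by (intro mult_right_mono) auto
    also have "\<dots> \<le> \<bar>C\<bar> * 1" using that by (intro mult_left_mono) auto
    finally show ?thesis by simp
  qed
  then have "bdd_above ((\<lambda>F. cmod (\<chi> F)) ` {F \<in> hinf. hinf_norm F \<le> 1})" by (rule bdd_aboveI2)
  then show ?thesis unfolding dual_norm_def using F F1 by (intro cSUP_upper) auto
qed

lemma cmod_diff_le_dual_norm:
  assumes \<chi>: "bounded_functional \<chi>" and F: "F \<in> hinf" and G: "G \<in> hinf"
    and M: "hinf_norm F \<le> M" "hinf_norm G \<le> M" "0 < M"
  shows "cmod (\<chi> F - \<chi> G) \<le> 2 * M * dual_norm \<chi>"
proof -
  let ?a = "complex_of_real (1 / (2 * M))"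
  let ?H = "\<lambda>P \<in> bidisk. ?a \<cdot>\<^sub>m F P + (- ?a) \<cdot>\<^sub>m G P"
  have "hinf_norm ?H \<le> 1"
  proof (rule hinf_norm_le)
    fix P assume P: "P \<in> bidisk"
    have "op_norm (?H P) \<le> cmod ?a * hinf_norm F + cmod (- ?a) * hinf_norm G"
      using op_norm_lincomb_hinf_le[OF F G P, of ?a "- ?a"] P by simp
    also have "\<dots> \<le> cmod ?a * M + cmod (- ?a) * M"
      using M by (intro add_mono mult_left_mono) auto
    also have "\<dots> = 1" using M by (simp add: norm_divide)
    finally show "op_norm (?H P) \<le> 1" .
  qed
  then have "cmod (\<chi> ?H) \<le> dual_norm \<chi>"
    by (rule cmod_le_dual_norm[OF \<chi> lincomb_in_hinf[OF F G]])
  moreover have "\<chi> ?H = ?a * (\<chi> F - \<chi> G)"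
    unfolding bounded_functional_lincomb[OF \<chi> F G] by (simp add: diff_divide_distrib)
  ultimately have "1 / (2 * M) * cmod (\<chi> F - \<chi> G) \<le> dual_norm \<chi>"
    using M(3) by (simp add: norm_mult norm_divide)
  then show ?thesis using M(3) by (simp add: field_simps)
qed

definition pointwise_limit :: "(nat \<Rightarrow> mat_pair \<Rightarrow> complex mat) \<Rightarrow> (mat_pair \<Rightarrow> complex mat) \<Rightarrow> bool"
  where "pointwise_limit F G \<longleftrightarrow> (\<forall>n. \<forall>P \<in> bidisk_level n. \<forall>i < n. \<forall>j < n.
    (\<lambda>k. F k P $$ (i, j)) \<longlonglongrightarrow> G P $$ (i, j))"

lemma point_functional_tendsto:
  assumes \<phi>: "\<phi> \<in> point_functionals" and F: "\<And>k. F k \<in> hinf" and G: "G \<in> hinf"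
    and lim: "pointwise_limit F G"
  shows "(\<lambda>k. \<phi> (F k)) \<longlonglongrightarrow> \<phi> G"
proof -
  obtain n P \<eta> where P: "P \<in> bidisk_level n" and \<eta>: "\<eta> \<in> mat_functionals n"
    and \<phi>: "\<phi> = (\<lambda>F \<in> hinf. \<eta> (F P))"
    using \<phi> unfolding point_functionals_def by blast
  obtain c where c: "\<And>A. A \<in> carrier_mat n n \<Longrightarrow> \<eta> A = (\<Sum>p \<in> {..<n} \<times> {..<n}. A $$ p * c p)"
    using mat_functional_sum[OF \<eta>] by blast
  have "(\<lambda>k. \<Sum>p \<in> {..<n} \<times> {..<n}. F k P $$ p * c p) \<longlonglongrightarrow> (\<Sum>p \<in> {..<n} \<times> {..<n}. G P $$ p * c p)"
    using lim P unfolding pointwise_limit_def by (intro tendsto_sum tendsto_mult) auto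
  then show ?thesis
    unfolding \<phi> using F G by (simp add: c[OF hinf_carrier[OF F P]] c[OF hinf_carrier[OF G P]])
qed

text \<open>An \<open>\<epsilon>/2\<close> argument: on a ball of radius \<open>N\<close> a functional \<open>\<phi>\<close> in the predual differs from some
  \<open>\<psi>\<close> in \<^const>\<open>point_span\<close> by little, and \<open>\<psi>\<close> depends on finitely many matrix entries only.\<close>

lemma predual_tendsto:
  assumes \<phi>: "\<phi> \<in> predual" and F: "\<And>k. F k \<in> hinf" and M: "\<And>k. hinf_norm (F k) \<le> M"
    and G: "G \<in> hinf" and lim: "pointwise_limit F G"
  shows "(\<lambda>k. \<phi> (F k)) \<longlonglongrightarrow> \<phi> G"
proof (rule LIMSEQ_I)
  fix e :: real assume "0 < e"
  define N where "N = max (max M (hinf_norm G)) 1"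
  have N: "0 < N" "hinf_norm G \<le> N" "\<And>k. hinf_norm (F k) \<le> N"
    using M unfolding N_def by (auto simp: le_max_iff_disj)
  obtain \<psi> where \<psi>: "\<psi> \<in> point_span" and near: "dual_norm (\<lambda>F. \<phi> F - \<psi> F) < e / (4 * N)"
    using \<phi> \<open>0 < e\<close> N(1) unfolding predual_def by (auto elim!: allE[of _ "e / (4 * N)"])
  have "bounded_functional \<phi>"
    using \<phi> unfolding predual_def hinf_dual_def bounded_functional_def by blast
  from bounded_functional_combine[OF this bounded_functional_point_span[OF \<psi>], of 1 "-1"]
  have \<chi>: "bounded_functional (\<lambda>F. \<phi> F - \<psi> F)" by simp
  have "(\<lambda>k. \<psi> (F k)) \<longlonglongrightarrow> \<psi> G"
  proof -
    obtain A c where A: "finite A" "A \<subseteq> point_functionals"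
      and \<psi>_eq: "\<psi> = (\<lambda>F \<in> hinf. \<Sum>\<phi> \<in> A. c \<phi> * \<phi> F)"
      using \<psi> by (rule point_spanE)
    have "(\<lambda>k. \<Sum>\<phi> \<in> A. c \<phi> * \<phi> (F k)) \<longlonglongrightarrow> (\<Sum>\<phi> \<in> A. c \<phi> * \<phi> G)"
      using A by (intro tendsto_sum tendsto_mult tendsto_const point_functional_tendsto[OF _ F G lim]) auto
    then show ?thesis unfolding \<psi>_eq using F G by simp
  qed
  then obtain k0 where k0: "\<And>k. k \<ge> k0 \<Longrightarrow> cmod (\<psi> (F k) - \<psi> G) < e / 2"
    using \<open>0 < e\<close> LIMSEQ_D[of _ _ "e / 2"] by (metis half_gt_zero)
  have "cmod (\<phi> (F k) - \<phi> G) < e" if "k \<ge> k0" for k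
  proof -
    have "cmod ((\<phi> (F k) - \<psi> (F k)) - (\<phi> G - \<psi> G)) \<le> 2 * N * dual_norm (\<lambda>F. \<phi> F - \<psi> F)"
      by (rule cmod_diff_le_dual_norm[OF \<chi> F G N(3) N(2) N(1)])
    also have "\<dots> < 2 * N * (e / (4 * N))" using near N(1) by (intro mult_strict_left_mono) auto
    also have "\<dots> = e / 2" using N(1) by simp
    finally have "cmod ((\<phi> (F k) - \<psi> (F k)) - (\<phi> G - \<psi> G)) < e / 2" .
    moreover have "\<phi> (F k) - \<phi> G = ((\<phi> (F k) - \<psi> (F k)) - (\<phi> G - \<psi> G)) + (\<psi> (F k) - \<psi> G)" by simp
    ultimately show ?thesis using k0[OF that] norm_triangle_lt by (smt (verit) field_sum_of_halves)
  qed
  then show "\<exists>k0. \<forall>k \<ge> k0. cmod (\<phi> (F k) - \<phi> G) < e" by blast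
qed

lemma zero_in_predual: "(\<lambda>F \<in> hinf. 0) \<in> predual"
proof -
  let ?Z = "\<lambda>P \<in> bidisk. 0\<^sub>m (dim_row (fst P)) (dim_row (fst P))"
  have "?Z \<in> {F \<in> hinf. hinf_norm F \<le> 1}"
    using zero_in_hinf hinf_norm_le[of ?Z 1] by (simp add: op_norm_zero_mat)
  then have ne: "{F \<in> hinf. hinf_norm F \<le> 1} \<noteq> {}" by blast
  have zero: "(\<lambda>F \<in> hinf. 0) \<in> point_span"
    unfolding point_span_def by (auto intro!: exI[of _ "{}"])
  have "(\<lambda>F \<in> hinf. 0) \<in> hinf_dual"
    using bounded_functional_point_span[OF zero] unfolding hinf_dual_def bounded_functional_def by simp
  moreover have "dual_norm (\<lambda>F. (\<lambda>F \<in> hinf. 0) F - (\<lambda>F \<in> hinf. 0) F) = 0"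
    unfolding dual_norm_def using ne by simp
  ultimately show ?thesis using zero unfolding predual_def by force
qed

lemma topspace_weak_star: "topspace weak_star = hinf"
  unfolding weak_star_def topology_generated_by_topspace using zero_in_predual by blast

text \<open>The open sets are generated from a subbase, so it suffices to check the subbasic sets and that the
  property passes to finite intersections and arbitrary unions.\<close>

lemma eventually_in_weak_star_open:
  assumes "openin weak_star T" "G \<in> T"
    and F: "\<And>k. F k \<in> hinf" and M: "\<And>k. hinf_norm (F k) \<le> M" and lim: "pointwise_limit F G"
  shows "\<forall>\<^sub>F k in sequentially. F k \<in> T"
  using assms(1)[unfolded weak_star_def openin_topology_generated_by_iff] assms(2)
proof (induction rule: generate_topology_on.induct)
  case (Basis s)
  then obtain \<phi> U where \<phi>: "\<phi> \<in> predual" and U: "open U" and s: "s = {F \<in> hinf. \<phi> F \<in> U}" by blast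
  then have "(\<lambda>k. \<phi> (F k)) \<longlonglongrightarrow> \<phi> G"
    using Basis.prems by (intro predual_tendsto[OF _ F M _ lim]) auto
  then have "\<forall>\<^sub>F k in sequentially. \<phi> (F k) \<in> U"
    using U Basis.prems s by (intro topological_tendstoD) auto
  then show ?case unfolding s using F by simp
next
  case (UN K)
  then obtain U where "U \<in> K" "\<forall>\<^sub>F k in sequentially. F k \<in> U" by blast
  then show ?case by (auto elim: eventually_mono)
qed (auto intro: eventually_conj)

lemma weak_star_dense_if_bounded_pointwise_limits:
  assumes "\<And>G. G \<in> hinf \<Longrightarrow>
    \<exists>F M. (\<forall>k. F k \<in> S \<inter> hinf \<and> hinf_norm (F k) \<le> M) \<and> pointwise_limit F G"
  shows "weak_star_dense S"
  unfolding weak_star_dense_def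
proof (intro equalityI subsetI)
  show "G \<in> hinf" if "G \<in> weak_star closure_of S" for G
    using that closure_of_subset_topspace[of weak_star S] topspace_weak_star by blast
next
  fix G assume G: "G \<in> hinf"
  then obtain F M where F: "\<And>k. F k \<in> S" "\<And>k. F k \<in> hinf" "\<And>k. hinf_norm (F k) \<le> M"
    and lim: "pointwise_limit F G"
    using assms by blast
  have "\<exists>y. y \<in> S \<and> y \<in> T" if T: "openin weak_star T" "G \<in> T" for T
    using eventually_in_weak_star_open[OF T F(2,3) lim] F(1)
    unfolding eventually_sequentially by blast
  then show "G \<in> weak_star closure_of S"
    unfolding in_closure_of topspace_weak_star using G by blast
qed

section \<open>Accretive stable functions are cyclic\<close>

lemma add_smult_one_mult_vec:
  assumes Q: "Q \<in> carrier_mat n n" and v: "v \<in> carrier_vec n"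
  shows "(Q + c \<cdot>\<^sub>m 1\<^sub>m n) *\<^sub>v v = Q *\<^sub>v v + c \<cdot>\<^sub>v (v :: complex vec)"
  using assms
  by (intro eq_vecI) (auto simp: add_scalar_prod_distrib[of _ n] scalar_prod_left_unit[where n = n])

text \<open>Accretivity of \<open>Q\<close> makes the cross term in
  \<open>\<parallel>(Q + c) v\<parallel>\<^sup>2 = \<parallel>Q v\<parallel>\<^sup>2 + 2 c Re \<langle>Q v, v\<rangle> + \<parallel>c v\<parallel>\<^sup>2\<close> non-negative, so \<open>Q + c\<close> dominates
  both \<open>c\<close> and \<open>Q\<close>.\<close>

lemma accretive_resolvent:
  assumes Q: "Q \<in> carrier_mat n n" and c: "0 < c"
    and accretive: "\<And>v. v \<in> carrier_vec n \<Longrightarrow> 0 \<le> Re ((Q *\<^sub>v v) \<bullet>c v)"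
  obtains K where "mutually_inverse n (Q + complex_of_real c \<cdot>\<^sub>m 1\<^sub>m n) K"
    "op_norm K \<le> 1 / c" "op_norm (Q * K) \<le> 1"
proof -
  let ?R = "Q + complex_of_real c \<cdot>\<^sub>m 1\<^sub>m n"
  have R: "?R \<in> carrier_mat n n" using Q by simp
  have sq: "(vec_norm (?R *\<^sub>v v))\<^sup>2
      = (vec_norm (Q *\<^sub>v v))\<^sup>2 + 2 * c * Re ((Q *\<^sub>v v) \<bullet>c v) + (c * vec_norm v)\<^sup>2"
    if v: "v \<in> carrier_vec n" for v
  proof -
    have Qv: "Q *\<^sub>v v \<in> carrier_vec n" by (rule mult_mat_vec_carrier[OF Q v])
    show ?thesis
      unfolding add_smult_one_mult_vec[OF Q v] using v c
      by (subst vec_norm_power2_add[OF Qv]) (simp_all add: cscalar_prod_smult_right[OF Qv v] vec_norm_smult)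
  qed
  have ge_Q: "vec_norm (Q *\<^sub>v v) \<le> vec_norm (?R *\<^sub>v v)" if v: "v \<in> carrier_vec n" for v
    by (rule power2_le_imp_le[OF _ vec_norm_nonneg]) (use sq[OF v] accretive[OF v] c in simp)
  have "c * vec_norm v \<le> vec_norm (?R *\<^sub>v v)" if v: "v \<in> carrier_vec n" for v
    by (rule power2_le_imp_le[OF _ vec_norm_nonneg]) (use sq[OF v] accretive[OF v] c in simp)
  then obtain K where K: "mutually_inverse n ?R K" and norm: "op_norm K \<le> 1 / c"
    using bounded_below_imp_inverse[OF R c] by blast
  have Kc: "K \<in> carrier_mat n n" and RK: "?R * K = 1\<^sub>m n"
    using K unfolding mutually_inverse_def by auto
  have "op_norm (Q * K) \<le> 1"
  proof (rule op_norm_le)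
    show "Q * K \<in> carrier_mat n n" using Q Kc by simp
    fix v :: "complex vec" assume v: "v \<in> carrier_vec n"
    have Kv: "K *\<^sub>v v \<in> carrier_vec n" by (rule mult_mat_vec_carrier[OF Kc v])
    have "?R *\<^sub>v (K *\<^sub>v v) = v"
      unfolding assoc_mult_mat_vec[OF R Kc v, symmetric] RK using v by simp
    then show "vec_norm (Q * K *\<^sub>v v) \<le> 1 * vec_norm v"
      unfolding assoc_mult_mat_vec[OF Q Kc v] using ge_Q[OF Kv] by simp
  qed simp
  with K norm show thesis by (rule that)
qed

lemma resolvent_identities:
  assumes Q: "Q \<in> carrier_mat n n" and K: "mutually_inverse n (Q + c \<cdot>\<^sub>m 1\<^sub>m n) K"
  shows "Q * K + c \<cdot>\<^sub>m K = 1\<^sub>m n" "K * Q = Q * K"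
proof -
  have Kc: "K \<in> carrier_mat n n" and RK: "(Q + c \<cdot>\<^sub>m 1\<^sub>m n) * K = 1\<^sub>m n"
    and KR: "K * (Q + c \<cdot>\<^sub>m 1\<^sub>m n) = 1\<^sub>m n"
    using K unfolding mutually_inverse_def by auto
  show 1: "Q * K + c \<cdot>\<^sub>m K = 1\<^sub>m n"
    using RK Q Kc by (simp add: add_mult_distrib_mat[of _ n n _ _ n] mult_smult_assoc_mat[of _ n n _ n])
  have 2: "K * Q + c \<cdot>\<^sub>m K = 1\<^sub>m n"
    using KR Q Kc by (simp add: mult_add_distrib_mat[of _ n n _ n] mult_smult_distrib[of _ n n _ n])
  show "K * Q = Q * K"
  proof (rule eq_matI)
    fix i j assume "i < dim_row (Q * K)" "j < dim_col (Q * K)"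
    then have "(K * Q + c \<cdot>\<^sub>m K) $$ (i, j) = (Q * K + c \<cdot>\<^sub>m K) $$ (i, j)" unfolding 1 2 by simp
    then show "(K * Q) $$ (i, j) = (Q * K) $$ (i, j)"
      using \<open>i < dim_row (Q * K)\<close> \<open>j < dim_col (Q * K)\<close> Q Kc by simp
  qed (use Q Kc in auto)
qed

text \<open>The form in which the resolvent identity \<open>Q K + c K = 1\<close> yields convergence: the error is
  \<open>c = 1/(k + 1)\<close> times a bounded sequence.\<close>

lemma pointwise_limitI:
  assumes "\<And>n P. P \<in> bidisk_level n \<Longrightarrow> \<exists>H C. \<forall>k. H k \<in> carrier_mat n n \<and> op_norm (H k) \<le> C \<and>
    F k P \<in> carrier_mat n n \<and> F k P + complex_of_real (1 / real (Suc k)) \<cdot>\<^sub>m H k = G P"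
  shows "pointwise_limit F G"
  unfolding pointwise_limit_def
proof (intro allI ballI impI)
  fix n P i j assume P: "P \<in> bidisk_level n" and ij: "i < n" "j < n"
  obtain H C where H: "\<And>k. H k \<in> carrier_mat n n" "\<And>k. op_norm (H k) \<le> C"
    and F: "\<And>k. F k P \<in> carrier_mat n n"
    and eq: "\<And>k. F k P + complex_of_real (1 / real (Suc k)) \<cdot>\<^sub>m H k = G P"
    using assms[OF P] by blast
  have le: "cmod (F k P $$ (i, j) - G P $$ (i, j)) \<le> C * (1 / real (Suc k))" for k
  proof -
    have "G P $$ (i, j) = F k P $$ (i, j) + complex_of_real (1 / real (Suc k)) * H k $$ (i, j)"
      using eq[of k, symmetric] F[of k] H(1)[of k] ij by simp
    then have "cmod (F k P $$ (i, j) - G P $$ (i, j)) = cmod (H k $$ (i, j)) * (1 / real (Suc k))"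
      by (simp add: norm_mult norm_divide del: of_nat_Suc)
    also have "\<dots> \<le> C * (1 / real (Suc k))"
      using entry_le_op_norm[OF H(1) ij, of k] H(2)[of k] by (intro mult_right_mono) auto
    finally show ?thesis .
  qed
  have "(\<lambda>k. C * (1 / real (Suc k))) \<longlonglongrightarrow> 0"
    using tendsto_mult_right_zero[OF LIMSEQ_inverse_real_of_nat, of C] by (simp add: inverse_eq_divide)
  then have "(\<lambda>k. F k P $$ (i, j) - G P $$ (i, j)) \<longlonglongrightarrow> 0"
  proof (rule tendsto_0_le[where K = 1])
    show "\<forall>\<^sub>F k in sequentially.
        cmod (F k P $$ (i, j) - G P $$ (i, j)) \<le> norm (C * (1 / real (Suc k))) * 1"
      unfolding real_norm_def mult_1_right
      by (intro always_eventually allI) (rule order_trans[OF le abs_ge_self])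
  qed
  then show "(\<lambda>k. F k P $$ (i, j)) \<longlonglongrightarrow> G P $$ (i, j)" by (simp add: LIM_zero_iff)
qed

text \<open>With \<open>K\<^sub>k = (F + 1/(k + 1))\<^sup>-\<^sup>1\<close>, the functions \<open>G K\<^sub>k F\<close> in the left ideal, and \<open>F K\<^sub>k G\<close> in the right
  ideal, are bounded by the norm of \<open>G\<close> and converge to \<open>G\<close> at every point.\<close>

theorem cyclic_if_accretive_invertible:
  assumes F: "F \<in> hinf"
    and accretive: "\<And>n P v. P \<in> bidisk_level n \<Longrightarrow> v \<in> carrier_vec n \<Longrightarrow> 0 \<le> Re ((F P *\<^sub>v v) \<bullet>c v)"
    and invertible: "\<And>n P. P \<in> bidisk_level n \<Longrightarrow> \<exists>R. mutually_inverse n (F P) R"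
  shows "left_cyclic F" "right_cyclic F"
proof -
  define c where "c k = 1 / real (Suc k)" for k
  define K where "K k P = the (mat_inverse (F P + complex_of_real (c k) \<cdot>\<^sub>m 1\<^sub>m (dim_row (fst P))))"
    for k and P :: mat_pair
  have c: "0 < c k" for k unfolding c_def by simp
  have K: "mutually_inverse n (F P + complex_of_real (c k) \<cdot>\<^sub>m 1\<^sub>m n) (K k P)"
      "op_norm (K k P) \<le> 1 / c k" "op_norm (F P * K k P) \<le> 1"
    if P: "P \<in> bidisk_level n" for k n P
  proof -
    obtain L where L: "mutually_inverse n (F P + complex_of_real (c k) \<cdot>\<^sub>m 1\<^sub>m n) L"
      "op_norm L \<le> 1 / c k" "op_norm (F P * L) \<le> 1"
      using accretive_resolvent[OF hinf_carrier[OF F P] c accretive[OF P]] by blast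
    moreover have "K k P = L"
      using mat_inverse_eq_Some[OF L(1)] bidisk_levelD(2)[OF P] unfolding K_def by simp
    ultimately show "mutually_inverse n (F P + complex_of_real (c k) \<cdot>\<^sub>m 1\<^sub>m n) (K k P)"
      "op_norm (K k P) \<le> 1 / c k" "op_norm (F P * K k P) \<le> 1" by auto
  qed
  have K_carrier: "K k P \<in> carrier_mat n n" if "P \<in> bidisk_level n" for k n P
    using K(1)[OF that] unfolding mutually_inverse_def by simp
  note F_carrier = hinf_carrier[OF F]
  have nc_K: "nc_function (K k)" for k
  proof (rule nc_function_inverse)
    show "nc_function (\<lambda>P. 1 \<cdot>\<^sub>m F P + complex_of_real (c k) \<cdot>\<^sub>m 1\<^sub>m (dim_row (fst P)))"
      by (intro nc_function_lincomb nc_function_one hinf_nc_function F)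
    show "mutually_inverse n (1 \<cdot>\<^sub>m F P + complex_of_real (c k) \<cdot>\<^sub>m 1\<^sub>m (dim_row (fst P))) (K k P)"
      if P: "P \<in> bidisk_level n" for n P
    proof -
      have "1 \<cdot>\<^sub>m F P = F P" by (intro eq_matI) auto
      then show ?thesis using K(1)[OF P] bidisk_levelD(2)[OF P] by simp
    qed
  qed
  have K_hinf: "restrict (K k) bidisk \<in> hinf" for k
    by (rule hinfI[OF nc_K, of _ "1 / c k"]) (auto elim!: bidisk_obtain_level intro: K(2))
  \<comment> \<open>The resolvents stay bounded at a fixed point as \<open>c k\<close> tends to \<open>0\<close>, since \<open>K = F\<^sup>-\<^sup>1 (F K)\<close> with \<open>F K\<close>
    contractive. The bound depends on the point, as \<open>F\<^sup>-\<^sup>1\<close> need not be bounded on the bidisk.\<close>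
  have K_bounded: "\<exists>C \<ge> 0. \<forall>k. op_norm (K k P) \<le> C" if P: "P \<in> bidisk_level n" for n P
  proof -
    obtain R where R: "mutually_inverse n (F P) R" using invertible[OF P] by blast
    then have Rc: "R \<in> carrier_mat n n" and RF: "R * F P = 1\<^sub>m n"
      unfolding mutually_inverse_def by auto
    have "op_norm (K k P) \<le> op_norm R" for k
    proof -
      have "K k P = (R * F P) * K k P" unfolding RF using K_carrier[OF P, of k] by simp
      also have "\<dots> = R * (F P * K k P)"
        by (rule assoc_mult_mat[OF Rc F_carrier[OF P] K_carrier[OF P]])
      finally have "op_norm (K k P) = op_norm (R * (F P * K k P))" by simp
      also have "\<dots> \<le> op_norm R * op_norm (F P * K k P)"
        by (rule op_norm_mult_le[OF Rc mult_carrier_mat[OF F_carrier[OF P] K_carrier[OF P]]])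
      also have "\<dots> \<le> op_norm R * 1" by (intro mult_left_mono K(3)[OF P] op_norm_nonneg)
      finally show ?thesis by simp
    qed
    then show ?thesis using op_norm_nonneg by blast
  qed
  have id: "F P * K k P + complex_of_real (c k) \<cdot>\<^sub>m K k P = 1\<^sub>m n" "K k P * F P = F P * K k P"
    if P: "P \<in> bidisk_level n" for k n P
    using resolvent_identities[OF F_carrier[OF P] K(1)[OF P]] by auto
  show "left_cyclic F"
    unfolding left_cyclic_def
  proof (intro conjI F weak_star_dense_if_bounded_pointwise_limits)
    fix G assume G: "G \<in> hinf"
    note G_carrier = hinf_carrier[OF G]
    define T where "T k = hinf_mult (hinf_mult G (restrict (K k) bidisk)) F" for k
    have T: "T k P = G P * (F P * K k P)" if P: "P \<in> bidisk_level n" for k n P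
      using bidisk_levelD(1)[OF P] id(2)[OF P, of k] assoc_mult_mat[OF G_carrier[OF P] K_carrier[OF P] F_carrier[OF P]]
      unfolding T_def hinf_mult_def by simp
    have "T k \<in> {hinf_mult G F | G. G \<in> hinf} \<inter> hinf" for k
      unfolding T_def using hinf_mult_in_hinf G K_hinf F by blast
    moreover have "hinf_norm (T k) \<le> hinf_norm G" for k
    proof (rule hinf_norm_le)
      fix P assume "P \<in> bidisk"
      then obtain n where P: "P \<in> bidisk_level n" by (rule bidisk_obtain_level)
      have "op_norm (T k P) \<le> op_norm (G P) * op_norm (F P * K k P)"
        unfolding T[OF P]
        by (rule op_norm_mult_le[OF G_carrier[OF P] mult_carrier_mat[OF F_carrier[OF P] K_carrier[OF P]]])
      also have "\<dots> \<le> hinf_norm G * 1"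
        by (intro mult_mono op_norm_le_hinf_norm G bidisk_levelD(1)[OF P] K(3)[OF P] op_norm_nonneg hinf_norm_nonneg)
      finally show "op_norm (T k P) \<le> hinf_norm G" by simp
    qed
    moreover have "pointwise_limit T G"
    proof (rule pointwise_limitI)
      fix n P assume P: "P \<in> bidisk_level n"
      obtain C where C: "0 \<le> C" "\<And>k. op_norm (K k P) \<le> C" using K_bounded[OF P] by blast
      note carriers = G_carrier[OF P] F_carrier[OF P] K_carrier[OF P]
      have "T k P + complex_of_real (c k) \<cdot>\<^sub>m (G P * K k P) = G P * (F P * K k P + complex_of_real (c k) \<cdot>\<^sub>m K k P)" for k
        unfolding T[OF P] using carriers
        by (simp add: mult_add_distrib_mat[of _ n n _ n] mult_smult_distrib[of _ n n _ n])
      then have "T k P + complex_of_real (c k) \<cdot>\<^sub>m (G P * K k P) = G P" for k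
        unfolding id(1)[OF P] using carriers by simp
      moreover have "op_norm (G P * K k P) \<le> op_norm (G P) * C" for k
        using op_norm_mult_le[OF carriers(1,3), of k] mult_left_mono[OF C(2)[of k] op_norm_nonneg[of "G P"]]
        by linarith
      moreover have "G P * K k P \<in> carrier_mat n n" "T k P \<in> carrier_mat n n" for k
        unfolding T[OF P] using carriers by (auto intro!: mult_carrier_mat[of _ n n _ n])
      ultimately show "\<exists>H C. \<forall>k. H k \<in> carrier_mat n n \<and> op_norm (H k) \<le> C \<and>
          T k P \<in> carrier_mat n n \<and> T k P + complex_of_real (1 / real (Suc k)) \<cdot>\<^sub>m H k = G P"
        unfolding c_def
        by (intro exI[of _ "\<lambda>k. G P * K k P"] exI[of _ "op_norm (G P) * C"] allI conjI) auto
    qed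
    ultimately show "\<exists>T M. (\<forall>k. T k \<in> {hinf_mult G F | G. G \<in> hinf} \<inter> hinf \<and> hinf_norm (T k) \<le> M)
        \<and> pointwise_limit T G" by blast
  qed
  show "right_cyclic F"
    unfolding right_cyclic_def
  proof (intro conjI F weak_star_dense_if_bounded_pointwise_limits)
    fix G assume G: "G \<in> hinf"
    note G_carrier = hinf_carrier[OF G]
    define T where "T k = hinf_mult F (hinf_mult (restrict (K k) bidisk) G)" for k
    have T: "T k P = F P * K k P * G P" if P: "P \<in> bidisk_level n" for k n P
      using bidisk_levelD(1)[OF P] assoc_mult_mat[OF F_carrier[OF P] K_carrier[OF P] G_carrier[OF P]]
      unfolding T_def hinf_mult_def by simp
    have "T k \<in> {hinf_mult F G | G. G \<in> hinf} \<inter> hinf" for k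
      unfolding T_def using hinf_mult_in_hinf G K_hinf F by blast
    moreover have "hinf_norm (T k) \<le> hinf_norm G" for k
    proof (rule hinf_norm_le)
      fix P assume "P \<in> bidisk"
      then obtain n where P: "P \<in> bidisk_level n" by (rule bidisk_obtain_level)
      have "op_norm (T k P) \<le> op_norm (F P * K k P) * op_norm (G P)"
        unfolding T[OF P]
        by (rule op_norm_mult_le[OF mult_carrier_mat[OF F_carrier[OF P] K_carrier[OF P]] G_carrier[OF P]])
      also have "\<dots> \<le> 1 * hinf_norm G"
        by (intro mult_mono op_norm_le_hinf_norm G bidisk_levelD(1)[OF P] K(3)[OF P] op_norm_nonneg) simp
      finally show "op_norm (T k P) \<le> hinf_norm G" by simp
    qed
    moreover have "pointwise_limit T G"
    proof (rule pointwise_limitI)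
      fix n P assume P: "P \<in> bidisk_level n"
      obtain C where C: "0 \<le> C" "\<And>k. op_norm (K k P) \<le> C" using K_bounded[OF P] by blast
      note carriers = G_carrier[OF P] F_carrier[OF P] K_carrier[OF P]
      have "T k P + complex_of_real (c k) \<cdot>\<^sub>m (K k P * G P) = (F P * K k P + complex_of_real (c k) \<cdot>\<^sub>m K k P) * G P" for k
        unfolding T[OF P] using carriers
        by (simp add: add_mult_distrib_mat[of _ n n _ _ n] mult_smult_assoc_mat[of _ n n _ n])
      then have "T k P + complex_of_real (c k) \<cdot>\<^sub>m (K k P * G P) = G P" for k
        unfolding id(1)[OF P] using carriers by simp
      moreover have "op_norm (K k P * G P) \<le> C * op_norm (G P)" for k
        using op_norm_mult_le[OF carriers(3,1), of k] mult_right_mono[OF C(2)[of k] op_norm_nonneg[of "G P"]]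
        by linarith
      moreover have "K k P * G P \<in> carrier_mat n n" "T k P \<in> carrier_mat n n" for k
        unfolding T[OF P] using carriers by (auto intro!: mult_carrier_mat[of _ n n _ n])
      ultimately show "\<exists>H C. \<forall>k. H k \<in> carrier_mat n n \<and> op_norm (H k) \<le> C \<and>
          T k P \<in> carrier_mat n n \<and> T k P + complex_of_real (1 / real (Suc k)) \<cdot>\<^sub>m H k = G P"
        unfolding c_def
        by (intro exI[of _ "\<lambda>k. K k P * G P"] exI[of _ "C * op_norm (G P)"] allI conjI) auto
    qed
    ultimately show "\<exists>T M. (\<forall>k. T k \<in> {hinf_mult F G | G. G \<in> hinf} \<inter> hinf \<and> hinf_norm (T k) \<le> M)
        \<and> pointwise_limit T G" by blast
  qed
qed

section \<open>Parallel sums of matrices\<close>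

text \<open>\<open>A C B\<close> is a product of invertible matrices with inverse \<open>B\<^sup>-\<^sup>1 (A + B) A\<^sup>-\<^sup>1\<close>, and this expands to
  \<open>B\<^sup>-\<^sup>1 + A\<^sup>-\<^sup>1\<close>.\<close>

lemma parallel_sum_inverse:
  assumes A: "mutually_inverse n A A'" and B: "mutually_inverse n B B'"
    and C: "mutually_inverse n (A + B) C"
  shows "mutually_inverse n (A * C * B) (A' + B')"
proof -
  have carriers: "A \<in> carrier_mat n n" "A' \<in> carrier_mat n n" "B \<in> carrier_mat n n" "B' \<in> carrier_mat n n"
    and one: "A * A' = 1\<^sub>m n" "B' * B = 1\<^sub>m n"
    using A B unfolding mutually_inverse_def by auto
  have "B' * ((A + B) * A') = B' * (A * A') + (B' * B) * A'"
    using carriers by (simp add: add_mult_distrib_mat[of _ n n _ _ n] mult_add_distrib_mat[of _ n n _ n]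
        assoc_mult_mat[of _ n n _ n _ n])
  also have "\<dots> = A' + B'"
    unfolding one using carriers by (simp add: comm_add_mat[of _ n n])
  finally show ?thesis
    using mutually_inverse_mult[OF mutually_inverse_mult[OF A mutually_inverse_sym[OF C]] B] by simp
qed

lemma inverse_scalar_minus:
  assumes Z: "Z \<in> carrier_mat n n" and r: "op_norm Z < r"
  obtains B where "mutually_inverse n (complex_of_real r \<cdot>\<^sub>m 1\<^sub>m n - Z) B"
proof -
  let ?A = "complex_of_real r \<cdot>\<^sub>m 1\<^sub>m n - Z"
  have A: "?A \<in> carrier_mat n n" using Z by (intro minus_carrier_mat)
  have "(r - op_norm Z) * vec_norm v \<le> vec_norm (?A *\<^sub>v v)" if v: "v \<in> carrier_vec n" for v
  proof -
    have "(complex_of_real r \<cdot>\<^sub>m 1\<^sub>m n) *\<^sub>v v = complex_of_real r \<cdot>\<^sub>v v"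
      using v by (intro eq_vecI) auto
    then have "?A *\<^sub>v v = complex_of_real r \<cdot>\<^sub>v v - Z *\<^sub>v v"
      using minus_mult_distrib_mat_vec[of "complex_of_real r \<cdot>\<^sub>m 1\<^sub>m n" n n Z v] Z v by simp
    then have "vec_norm (complex_of_real r \<cdot>\<^sub>v v) - vec_norm (Z *\<^sub>v v) \<le> vec_norm (?A *\<^sub>v v)"
      using vec_norm_diff_triangle[of "complex_of_real r \<cdot>\<^sub>v v" n "Z *\<^sub>v v"] v
        mult_mat_vec_carrier[OF Z v] by simp
    then show ?thesis
      using vec_norm_mult_mat_vec_le[OF Z v] r op_norm_nonneg[of Z]
      by (simp add: vec_norm_smult algebra_simps)
  qed
  then show thesis using bounded_below_imp_inverse[OF A, of "r - op_norm Z"] r that by auto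
qed

text \<open>For \<open>a = (1 - X)\<^sup>-\<^sup>1 u\<close> one has \<open>a - u = X a\<close>. Hence \<open>\<parallel>a - u\<parallel> \<le> \<parallel>a\<parallel>\<close>, and expanding the square
  gives \<open>\<parallel>u\<parallel>\<^sup>2 \<le> 2 Re \<langle>u, a\<rangle>\<close>: the real part of \<open>(1 - X)\<^sup>-\<^sup>1\<close> is at least \<open>1/2\<close>.\<close>

lemma re_inverse_one_minus_contraction:
  assumes X: "X \<in> carrier_mat n n" and X1: "op_norm X \<le> 1"
    and A: "mutually_inverse n (1\<^sub>m n - X) A" and u: "u \<in> carrier_vec n"
  shows "(vec_norm u)\<^sup>2 \<le> 2 * Re (u \<bullet>c (A *\<^sub>v u))"
proof -
  define a where "a = A *\<^sub>v u"
  have Ac: "A \<in> carrier_mat n n" and one: "(1\<^sub>m n - X) * A = 1\<^sub>m n"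
    using A unfolding mutually_inverse_def by auto
  have a: "a \<in> carrier_vec n" unfolding a_def by (rule mult_mat_vec_carrier[OF Ac u])
  have Xa: "X *\<^sub>v a \<in> carrier_vec n" by (rule mult_mat_vec_carrier[OF X a])
  have Xc: "1\<^sub>m n - X \<in> carrier_mat n n" using X by (rule minus_carrier_mat)
  have "(1\<^sub>m n - X) *\<^sub>v a = u"
    unfolding a_def assoc_mult_mat_vec[OF Xc Ac u, symmetric] one using u by simp
  moreover have "(1\<^sub>m n - X) *\<^sub>v a = a - X *\<^sub>v a"
    using minus_mult_distrib_mat_vec[of "1\<^sub>m n" n n X a] X a by simp
  ultimately have u_eq: "u = a - X *\<^sub>v a" by simp
  have a_eq: "a = u + X *\<^sub>v a" unfolding u_eq using a Xa carrier_matD[OF X] by (intro eq_vecI) auto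
  have "(vec_norm a)\<^sup>2 = (vec_norm u)\<^sup>2 + 2 * Re (u \<bullet>c (X *\<^sub>v a)) + (vec_norm (X *\<^sub>v a))\<^sup>2"
    using vec_norm_power2_add[OF u Xa] a_eq by simp
  moreover have "Re (u \<bullet>c a) = (vec_norm u)\<^sup>2 + Re (u \<bullet>c (X *\<^sub>v a))"
    using cscalar_prod_add_right[OF u u Xa] a_eq vec_norm_power2[OF u] by simp
  moreover have "(vec_norm (X *\<^sub>v a))\<^sup>2 \<le> (vec_norm a)\<^sup>2"
  proof (rule power_mono[OF _ vec_norm_nonneg])
    show "vec_norm (X *\<^sub>v a) \<le> vec_norm a"
      using vec_norm_mult_mat_vec_le[OF X a] mult_right_mono[OF X1 vec_norm_nonneg[of a]] by simp
  qed
  ultimately show ?thesis unfolding a_def[symmetric] by simp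
qed

text \<open>For \<open>u = Q v\<close> the vector \<open>v\<close> is \<open>A u + B u\<close>, where \<open>A\<close> and \<open>B\<close>, the inverses of \<open>1 - X\<close> and \<open>1 - Y\<close>,
  contribute at least half of \<open>\<parallel>u\<parallel>\<^sup>2\<close> each to \<open>Re \<langle>u, v\<rangle>\<close>.\<close>

lemma parallel_sum_firmly_contractive:
  assumes X: "X \<in> carrier_mat n n" "op_norm X \<le> 1" and Y: "Y \<in> carrier_mat n n" "op_norm Y \<le> 1"
    and A: "mutually_inverse n (1\<^sub>m n - X) A" and B: "mutually_inverse n (1\<^sub>m n - Y) B"
    and Q: "mutually_inverse n Q (A + B)" and v: "v \<in> carrier_vec n"
  shows "(vec_norm (Q *\<^sub>v v))\<^sup>2 \<le> Re ((Q *\<^sub>v v) \<bullet>c v)"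
proof -
  have carriers: "A \<in> carrier_mat n n" "B \<in> carrier_mat n n" "Q \<in> carrier_mat n n"
    and one: "(A + B) * Q = 1\<^sub>m n"
    using A B Q unfolding mutually_inverse_def by auto
  define u where "u = Q *\<^sub>v v"
  have u: "u \<in> carrier_vec n" unfolding u_def by (rule mult_mat_vec_carrier[OF carriers(3) v])
  have "(A + B) *\<^sub>v u = ((A + B) * Q) *\<^sub>v v"
    unfolding u_def by (rule assoc_mult_mat_vec[symmetric, of _ n n _ n]) (use carriers v in auto)
  then have "v = A *\<^sub>v u + B *\<^sub>v u"
    unfolding one using carriers u v add_mult_distrib_mat_vec[of A n n B u] by simp
  then have "u \<bullet>c v = u \<bullet>c (A *\<^sub>v u) + u \<bullet>c (B *\<^sub>v u)"
    using cscalar_prod_add_right[OF u mult_mat_vec_carrier[OF carriers(1) u]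
        mult_mat_vec_carrier[OF carriers(2) u]] by simp
  then show ?thesis
    using re_inverse_one_minus_contraction[OF X A u] re_inverse_one_minus_contraction[OF Y B u]
    unfolding u_def[symmetric] by simp
qed

lemma firmly_contractive_op_norm_le:
  assumes Q: "Q \<in> carrier_mat n n"
    and firm: "\<And>v. v \<in> carrier_vec n \<Longrightarrow> (vec_norm (Q *\<^sub>v v))\<^sup>2 \<le> Re ((Q *\<^sub>v v) \<bullet>c v)"
  shows "op_norm Q \<le> 1"
proof (rule op_norm_le[OF Q])
  fix v :: "complex vec" assume v: "v \<in> carrier_vec n"
  have "(vec_norm (Q *\<^sub>v v))\<^sup>2 \<le> vec_norm (Q *\<^sub>v v) * vec_norm v"
    using firm[OF v] complex_Re_le_cmod[of "(Q *\<^sub>v v) \<bullet>c v"]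
      Cauchy_Schwarz_vec[OF mult_mat_vec_carrier[OF Q v] v] by linarith
  then show "vec_norm (Q *\<^sub>v v) \<le> 1 * vec_norm v"
    using vec_norm_nonneg[of "Q *\<^sub>v v"] vec_norm_nonneg[of v]
    by (cases "vec_norm (Q *\<^sub>v v) = 0") (auto simp: power2_eq_square)
qed simp

section \<open>Evaluating the parallel sum\<close>

lemma poly_eval_superset:
  assumes "finite S" "Poly_Mapping.keys p \<subseteq> S"
  shows "poly_eval p P = mat (dim_row (fst P)) (dim_row (fst P))
     (\<lambda>ij. \<Sum>w \<in> S. Poly_Mapping.lookup p w * (word_eval w P $$ ij))"
proof -
  have "(\<Sum>w \<in> Poly_Mapping.keys p. Poly_Mapping.lookup p w * (word_eval w P $$ ij))
      = (\<Sum>w \<in> S. Poly_Mapping.lookup p w * (word_eval w P $$ ij))" for ij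
    using assms by (intro sum.mono_neutral_left) (auto simp: in_keys_iff)
  then show ?thesis unfolding poly_eval_def by simp
qed

lemma poly_eval_diff: "poly_eval (p - q) P = poly_eval p P - poly_eval q P"
proof -
  let ?S = "Poly_Mapping.keys p \<union> Poly_Mapping.keys q"
  have S: "finite ?S" "Poly_Mapping.keys p \<subseteq> ?S" "Poly_Mapping.keys q \<subseteq> ?S"
    "Poly_Mapping.keys (p - q) \<subseteq> ?S"
    using keys_diff[of p q] by auto
  show ?thesis
    unfolding poly_eval_superset[OF S(1,2)] poly_eval_superset[OF S(1,3)] poly_eval_superset[OF S(1,4)]
    by (intro eq_matI) (auto simp: lookup_minus left_diff_distrib sum_subtractf)
qed

lemma poly_eval_const: "poly_eval (const_poly c) P = c \<cdot>\<^sub>m 1\<^sub>m (dim_row (fst P))"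
  unfolding const_poly_def
  by (subst poly_eval_superset[of "{[]}"]) (auto simp: word_eval_def intro!: eq_matI)

lemma poly_eval_var:
  assumes "X \<in> carrier_mat n n" "Y \<in> carrier_mat n n"
  shows "poly_eval (var_poly VarZ) (X, Y) = X" "poly_eval (var_poly VarW) (X, Y) = Y"
  using assms unfolding var_poly_def
  by (auto simp: poly_eval_superset[of "{[VarZ]}"] poly_eval_superset[of "{[VarW]}"] word_eval_def
      intro!: eq_matI)

lemma poly_eval_one_minus:
  assumes "X \<in> carrier_mat n n" "Y \<in> carrier_mat n n"
  shows "poly_eval (const_poly 1 - var_poly VarZ) (X, Y) = 1\<^sub>m n - X"
    "poly_eval (const_poly 1 - var_poly VarW) (X, Y) = 1\<^sub>m n - Y"
  using assms unfolding poly_eval_diff poly_eval_const poly_eval_var[OF assms]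
  by (auto intro!: eq_matI)

lemma poly_eval_two_minus:
  assumes "X \<in> carrier_mat n n" "Y \<in> carrier_mat n n"
  shows "poly_eval (const_poly 2 - var_poly VarZ - var_poly VarW) (X, Y) = (1\<^sub>m n - X) + (1\<^sub>m n - Y)"
  using assms unfolding poly_eval_diff poly_eval_const poly_eval_var[OF assms]
  by (auto intro!: eq_matI)

lemma eval_parallel_sum_expr_iff:
  assumes XY: "X \<in> carrier_mat n n" "Y \<in> carrier_mat n n"
  shows "expr_eval parallel_sum_expr (X, Y) = Some V \<longleftrightarrow>
    (\<exists>C. mutually_inverse n ((1\<^sub>m n - X) + (1\<^sub>m n - Y)) C \<and> V = (1\<^sub>m n - X) * C * (1\<^sub>m n - Y))"
proof -
  have "(1\<^sub>m n - X) + (1\<^sub>m n - Y) \<in> carrier_mat n n" using XY by (intro add_carrier_mat minus_carrier_mat)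
  then have "mat_inverse ((1\<^sub>m n - X) + (1\<^sub>m n - Y)) = Some C
      \<longleftrightarrow> mutually_inverse n ((1\<^sub>m n - X) + (1\<^sub>m n - Y)) C" for C
    using mat_inverse_eq_Some mutually_inverse_mat_inverse by blast
  then show ?thesis
    unfolding parallel_sum_expr_def
    by (auto simp: poly_eval_one_minus[OF XY] poly_eval_two_minus[OF XY] split: option.splits
        dest: mutually_inverse_unique)
qed

lemma eval_parallel_sum_expr'_iff:
  assumes XY: "X \<in> carrier_mat n n" "Y \<in> carrier_mat n n"
  shows "expr_eval parallel_sum_expr' (X, Y) = Some V \<longleftrightarrow>
    (\<exists>A B. mutually_inverse n (1\<^sub>m n - X) A \<and> mutually_inverse n (1\<^sub>m n - Y) B \<and> mutually_inverse n (A + B) V)"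
proof -
  have inv: "mat_inverse Z = Some C \<longleftrightarrow> mutually_inverse n Z C" if "Z \<in> carrier_mat n n" for Z C
    using that mat_inverse_eq_Some mutually_inverse_mat_inverse by blast
  have X: "1\<^sub>m n - X \<in> carrier_mat n n" and Y: "1\<^sub>m n - Y \<in> carrier_mat n n"
    using XY by (auto intro!: minus_carrier_mat)
  have "expr_eval parallel_sum_expr' (X, Y) = Some V \<longleftrightarrow>
    (\<exists>A B. mat_inverse (1\<^sub>m n - X) = Some A \<and> mat_inverse (1\<^sub>m n - Y) = Some B \<and> mat_inverse (A + B) = Some V)"
    unfolding parallel_sum_expr'_def
    by (auto simp: poly_eval_one_minus[OF XY] split: option.splits)
  moreover have "A + B \<in> carrier_mat n n"
    if "mutually_inverse n (1\<^sub>m n - X) A" "mutually_inverse n (1\<^sub>m n - Y) B" for A B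
    using that unfolding mutually_inverse_def by simp
  ultimately show ?thesis unfolding inv[OF X] inv[OF Y] using inv by blast
qed

text \<open>\<open>1 - X\<close>, \<open>1 - Y\<close> and \<open>2 - (X + Y)\<close> are invertible because \<open>X\<close>, \<open>Y\<close> and \<open>X + Y\<close> have norms
  less than \<open>1\<close>, \<open>1\<close> and \<open>2\<close>.\<close>

lemma parallel_sum_on_bidisk:
  assumes P: "P \<in> bidisk_level n"
  obtains A B V where "mutually_inverse n (1\<^sub>m n - fst P) A" "mutually_inverse n (1\<^sub>m n - snd P) B"
    "mutually_inverse n V (A + B)"
    "expr_eval parallel_sum_expr P = Some V" "expr_eval parallel_sum_expr' P = Some V"
proof -
  obtain X Y where P_eq: "P = (X, Y)" by (cases P)
  note XY = bidisk_levelD[OF P[unfolded P_eq], simplified]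
  have scalar: "complex_of_real 1 \<cdot>\<^sub>m 1\<^sub>m n = 1\<^sub>m n" by (intro eq_matI) auto
  obtain A where A: "mutually_inverse n (1\<^sub>m n - X) A"
    using inverse_scalar_minus[OF XY(2,5)] unfolding scalar by blast
  obtain B where B: "mutually_inverse n (1\<^sub>m n - Y) B"
    using inverse_scalar_minus[OF XY(3,6)] unfolding scalar by blast
  have sum: "1 \<cdot>\<^sub>m X + 1 \<cdot>\<^sub>m Y \<in> carrier_mat n n" using XY by simp
  have "op_norm (1 \<cdot>\<^sub>m X + 1 \<cdot>\<^sub>m Y) < 2"
    using op_norm_lincomb_le[OF XY(2,3), of 1 1] XY(5,6) by simp
  then obtain C where "mutually_inverse n (complex_of_real 2 \<cdot>\<^sub>m 1\<^sub>m n - (1 \<cdot>\<^sub>m X + 1 \<cdot>\<^sub>m Y)) C"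
    using inverse_scalar_minus[OF sum] by blast
  moreover have "complex_of_real 2 \<cdot>\<^sub>m 1\<^sub>m n - (1 \<cdot>\<^sub>m X + 1 \<cdot>\<^sub>m Y) = (1\<^sub>m n - X) + (1\<^sub>m n - Y)"
    using XY(2,3) by (intro eq_matI) auto
  ultimately have C: "mutually_inverse n ((1\<^sub>m n - X) + (1\<^sub>m n - Y)) C" by simp
  let ?V = "(1\<^sub>m n - X) * C * (1\<^sub>m n - Y)"
  have V: "mutually_inverse n ?V (A + B)" by (rule parallel_sum_inverse[OF A B C])
  have "expr_eval parallel_sum_expr P = Some ?V" "expr_eval parallel_sum_expr' P = Some ?V"
    unfolding P_eq eval_parallel_sum_expr_iff[OF XY(2,3)] eval_parallel_sum_expr'_iff[OF XY(2,3)]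
    using A B C mutually_inverse_sym[OF V] by blast+
  then show thesis using that A B V unfolding P_eq by simp
qed

lemma bidisk_subset_expr_dom: "bidisk \<subseteq> expr_dom parallel_sum_expr" "bidisk \<subseteq> expr_dom parallel_sum_expr'"
proof -
  have "P \<in> expr_dom parallel_sum_expr \<and> P \<in> expr_dom parallel_sum_expr'" if P: "P \<in> bidisk" for P
  proof -
    obtain n where n: "P \<in> bidisk_level n" using P by (rule bidisk_obtain_level)
    obtain V where "expr_eval parallel_sum_expr P = Some V" "expr_eval parallel_sum_expr' P = Some V"
      by (rule parallel_sum_on_bidisk[OF n])
    moreover have "P \<in> nc_points" using P unfolding bidisk_def by blast
    ultimately show ?thesis unfolding expr_dom_def by simp
  qed
  then show "bidisk \<subseteq> expr_dom parallel_sum_expr" "bidisk \<subseteq> expr_dom parallel_sum_expr'" by auto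
qed

lemma parallel_sum_expr_nondegenerate:
  "parallel_sum_expr \<in> nondegenerate" "parallel_sum_expr' \<in> nondegenerate"
  using bidisk_subset_expr_dom bidisk_nonempty unfolding nondegenerate_def by auto

lemma parallel_sum_exprs_equiv: "(parallel_sum_expr, parallel_sum_expr') \<in> expr_equiv"
proof -
  have "expr_eval parallel_sum_expr P = expr_eval parallel_sum_expr' P"
    if P: "P \<in> expr_dom parallel_sum_expr \<inter> expr_dom parallel_sum_expr'" for P
  proof -
    obtain X Y n where P_eq: "P = (X, Y)" and XY: "X \<in> carrier_mat n n" "Y \<in> carrier_mat n n"
      using P unfolding expr_dom_def nc_points_def by blast
    obtain V V' where V: "expr_eval parallel_sum_expr (X, Y) = Some V"
      and V': "expr_eval parallel_sum_expr' (X, Y) = Some V'"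
      using P unfolding P_eq expr_dom_def by auto
    obtain C where C: "mutually_inverse n ((1\<^sub>m n - X) + (1\<^sub>m n - Y)) C"
      and V_eq: "V = (1\<^sub>m n - X) * C * (1\<^sub>m n - Y)"
      using V unfolding eval_parallel_sum_expr_iff[OF XY] by blast
    obtain A B where A: "mutually_inverse n (1\<^sub>m n - X) A" and B: "mutually_inverse n (1\<^sub>m n - Y) B"
      and V'_inv: "mutually_inverse n (A + B) V'"
      using V' unfolding eval_parallel_sum_expr'_iff[OF XY] by blast
    have "mutually_inverse n (A + B) V"
      unfolding V_eq by (rule mutually_inverse_sym[OF parallel_sum_inverse[OF A B C]])
    then have "V = V'" using V'_inv by (rule mutually_inverse_unique)
    then show ?thesis using V V' unfolding P_eq by simp
  qed
  then show ?thesis unfolding expr_equiv_def using parallel_sum_expr_nondegenerate by simp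
qed

lemma parallel_sum_expr_in_class: "parallel_sum_expr \<in> parallel_sum"
  unfolding parallel_sum_def expr_equiv_def using parallel_sum_expr_nondegenerate by simp

lemma expr_eval_in_class:
  assumes "e \<in> parallel_sum" "P \<in> expr_dom parallel_sum_expr" "P \<in> expr_dom e"
  shows "expr_eval parallel_sum_expr P = expr_eval e P"
  using assms unfolding parallel_sum_def expr_equiv_def by blast

text \<open>The value of a class may be read off from an arbitrary representative, and each of them is
  by definition related to \<^const>\<open>parallel_sum_expr\<close>.\<close>

lemma eval_eq_rat_apply:
  assumes P: "P \<in> expr_dom parallel_sum_expr"
  shows "expr_eval parallel_sum_expr P = Some (rat_apply parallel_sum P)"
proof -
  let ?e = "SOME e. e \<in> parallel_sum \<and> P \<in> expr_dom e"
  have "?e \<in> parallel_sum \<and> P \<in> expr_dom ?e"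
    by (rule someI[of _ parallel_sum_expr]) (use P parallel_sum_expr_in_class in simp)
  then have "expr_eval parallel_sum_expr P = expr_eval ?e P" "expr_eval ?e P \<noteq> None"
    using expr_eval_in_class[OF _ P] unfolding expr_dom_def by auto
  then show ?thesis unfolding rat_apply_def by auto
qed

lemma rat_apply_parallel_sum:
  assumes P: "P \<in> bidisk_level n"
  obtains A B where "mutually_inverse n (1\<^sub>m n - fst P) A" "mutually_inverse n (1\<^sub>m n - snd P) B"
    "mutually_inverse n (rat_apply parallel_sum P) (A + B)"
    "expr_eval parallel_sum_expr P = Some (rat_apply parallel_sum P)"
    "expr_eval parallel_sum_expr' P = Some (rat_apply parallel_sum P)"
proof -
  have "P \<in> expr_dom parallel_sum_expr" using bidisk_subset_expr_dom bidisk_levelD(1)[OF P] by blast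
  then have "expr_eval parallel_sum_expr P = Some (rat_apply parallel_sum P)" by (rule eval_eq_rat_apply)
  moreover obtain A B V where "mutually_inverse n (1\<^sub>m n - fst P) A" "mutually_inverse n (1\<^sub>m n - snd P) B"
    "mutually_inverse n V (A + B)"
    "expr_eval parallel_sum_expr P = Some V" "expr_eval parallel_sum_expr' P = Some V"
    by (rule parallel_sum_on_bidisk[OF P])
  ultimately show thesis using that by simp
qed

lemma parallel_sum_firmly_contractive_on_bidisk:
  assumes P: "P \<in> bidisk_level n" and v: "v \<in> carrier_vec n"
  shows "(vec_norm (rat_apply parallel_sum P *\<^sub>v v))\<^sup>2 \<le> Re ((rat_apply parallel_sum P *\<^sub>v v) \<bullet>c v)"
proof -
  obtain A B where AB: "mutually_inverse n (1\<^sub>m n - fst P) A" "mutually_inverse n (1\<^sub>m n - snd P) B"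
    "mutually_inverse n (rat_apply parallel_sum P) (A + B)"
    by (rule rat_apply_parallel_sum[OF P])
  show ?thesis
    by (rule parallel_sum_firmly_contractive[OF _ _ _ _ AB v]) (use bidisk_levelD[OF P] in auto)
qed

lemma rat_apply_carrier:
  assumes "P \<in> bidisk_level n"
  shows "rat_apply parallel_sum P \<in> carrier_mat n n"
  by (rule rat_apply_parallel_sum[OF assms]) (simp add: mutually_inverse_def)

lemma accretive_rat_apply:
  assumes "P \<in> bidisk_level n" "v \<in> carrier_vec n"
  shows "0 \<le> Re ((rat_apply parallel_sum P *\<^sub>v v) \<bullet>c v)"
  using parallel_sum_firmly_contractive_on_bidisk[OF assms] zero_le_power2 order_trans by blast

lemma op_norm_rat_apply_le:
  assumes "P \<in> bidisk"
  shows "op_norm (rat_apply parallel_sum P) \<le> 1"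
proof -
  obtain n where n: "P \<in> bidisk_level n" using assms by (rule bidisk_obtain_level)
  show ?thesis
    by (rule firmly_contractive_op_norm_le[OF rat_apply_carrier[OF n]
          parallel_sum_firmly_contractive_on_bidisk[OF n]])
qed

lemma nc_function_inverse_one_minus:
  assumes F: "nc_function F" and inv: "\<And>n P. P \<in> bidisk_level n \<Longrightarrow> mutually_inverse n (1\<^sub>m n - F P) (G P)"
  shows "nc_function G"
proof (rule nc_function_inverse)
  show "nc_function (\<lambda>P. 1 \<cdot>\<^sub>m 1\<^sub>m (dim_row (fst P)) + (-1) \<cdot>\<^sub>m F P)"
    by (rule nc_function_lincomb[OF nc_function_one F])
  fix n P assume P: "P \<in> bidisk_level n"
  have "1 \<cdot>\<^sub>m 1\<^sub>m (dim_row (fst P)) + (-1) \<cdot>\<^sub>m F P = 1\<^sub>m n - F P"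
    using bidisk_levelD(2)[OF P] nc_function_carrier[OF F P] by (intro eq_matI) auto
  then show "mutually_inverse n (1 \<cdot>\<^sub>m 1\<^sub>m (dim_row (fst P)) + (-1) \<cdot>\<^sub>m F P) (G P)"
    using inv[OF P] by simp
qed

text \<open>The formula \<open>((1 - Z)\<^sup>-\<^sup>1 + (1 - W)\<^sup>-\<^sup>1)\<^sup>-\<^sup>1\<close> builds the parallel sum from coordinate functions by linear
  combinations and inverses, which preserve the NC identities.\<close>

lemma nc_function_parallel_sum: "nc_function (rat_apply parallel_sum)"
proof -
  define A where "A P = the (mat_inverse (1\<^sub>m (dim_row (fst P)) - fst P))" for P :: mat_pair
  define B where "B P = the (mat_inverse (1\<^sub>m (dim_row (fst P)) - snd P))" for P :: mat_pair
  have AB: "mutually_inverse n (1\<^sub>m n - fst P) (A P)" "mutually_inverse n (1\<^sub>m n - snd P) (B P)"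
      "mutually_inverse n (A P + B P) (rat_apply parallel_sum P)"
    if P: "P \<in> bidisk_level n" for n P
  proof -
    obtain A' B' where *: "mutually_inverse n (1\<^sub>m n - fst P) A'" "mutually_inverse n (1\<^sub>m n - snd P) B'"
      "mutually_inverse n (rat_apply parallel_sum P) (A' + B')"
      by (rule rat_apply_parallel_sum[OF P])
    moreover have "A P = A'" "B P = B'"
      using mat_inverse_eq_Some[OF *(1)] mat_inverse_eq_Some[OF *(2)] bidisk_levelD(2)[OF P]
      unfolding A_def B_def by auto
    ultimately show "mutually_inverse n (1\<^sub>m n - fst P) (A P)" "mutually_inverse n (1\<^sub>m n - snd P) (B P)"
      "mutually_inverse n (A P + B P) (rat_apply parallel_sum P)"
      using mutually_inverse_sym by auto
  qed
  have "nc_function (\<lambda>P. 1 \<cdot>\<^sub>m A P + 1 \<cdot>\<^sub>m B P)"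
    using AB by (intro nc_function_lincomb nc_function_inverse_one_minus[OF nc_function_fst]
        nc_function_inverse_one_minus[OF nc_function_snd])
  moreover have "1 \<cdot>\<^sub>m M = M" for M :: "complex mat" by (intro eq_matI) auto
  ultimately have "nc_function (\<lambda>P. A P + B P)" by simp
  then show ?thesis by (rule nc_function_inverse) (fact AB(3))
qed

section \<open>Scalar points and the boundary point \<open>(1, 1)\<close>\<close>

definition scalar_mat :: "complex \<Rightarrow> complex mat" where
  "scalar_mat c = mat 1 1 (\<lambda>_. c)"

lemma scalar_mat_carrier: "scalar_mat c \<in> carrier_mat 1 1"
  unfolding scalar_mat_def by simp

lemma scalar_mat_arith:
  "scalar_mat a + scalar_mat b = scalar_mat (a + b)"
  "scalar_mat a - scalar_mat b = scalar_mat (a - b)"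
  "scalar_mat a * scalar_mat b = scalar_mat (a * b)"
  "1\<^sub>m 1 = scalar_mat 1"
  "a \<cdot>\<^sub>m scalar_mat b = scalar_mat (a * b)"
  unfolding scalar_mat_def by (auto intro!: eq_matI simp: scalar_prod_def)

lemma scalar_mat_inject: "scalar_mat a = scalar_mat b \<longleftrightarrow> a = b"
proof
  assume "scalar_mat a = scalar_mat b"
  then have "scalar_mat a $$ (0, 0) = scalar_mat b $$ (0, 0)" by simp
  then show "a = b" unfolding scalar_mat_def by simp
qed simp

lemma mutually_inverse_scalar_mat:
  assumes "c \<noteq> 0"
  shows "mutually_inverse 1 (scalar_mat c) (scalar_mat (1 / c))"
  unfolding mutually_inverse_def scalar_mat_arith using assms scalar_mat_carrier by simp

lemma mat_inverse_scalar_mat: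
  assumes "mat_inverse (scalar_mat c) = Some B"
  shows "c \<noteq> 0" "B = scalar_mat (1 / c)"
proof -
  have inv: "mutually_inverse 1 (scalar_mat c) B"
    by (rule mutually_inverse_mat_inverse[OF scalar_mat_carrier assms])
  show c: "c \<noteq> 0"
  proof
    assume "c = 0"
    then have "Determinant.det (scalar_mat c) = 0"
      by (subst det_single[OF scalar_mat_carrier]) (simp add: scalar_mat_def)
    then show False using mutually_inverse_det_nonzero[OF inv] by simp
  qed
  show "B = scalar_mat (1 / c)"
    by (rule mutually_inverse_unique[OF inv mutually_inverse_scalar_mat[OF c]])
qed

lemma op_norm_scalar_mat_le: "op_norm (scalar_mat c) \<le> cmod c"
proof (rule op_norm_le[OF scalar_mat_carrier])
  fix v :: "complex vec" assume v: "v \<in> carrier_vec 1"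
  then have "scalar_mat c *\<^sub>v v = c \<cdot>\<^sub>v v"
    unfolding scalar_mat_def by (intro eq_vecI) (auto simp: scalar_prod_def)
  then show "vec_norm (scalar_mat c *\<^sub>v v) \<le> cmod c * vec_norm v" by (simp add: vec_norm_smult)
qed simp

lemma scalar_point_in_nc_points: "(scalar_mat z, scalar_mat w) \<in> nc_points"
  unfolding nc_points_def using scalar_mat_carrier by blast

fun word_scalar :: "nc_var list \<Rightarrow> complex \<Rightarrow> complex \<Rightarrow> complex" where
  "word_scalar [] z w = 1"
| "word_scalar (VarZ # u) z w = z * word_scalar u z w"
| "word_scalar (VarW # u) z w = w * word_scalar u z w"

lemma word_eval_scalar: "word_eval u (scalar_mat z, scalar_mat w) = scalar_mat (word_scalar u z w)"
proof -
  have "foldr (\<lambda>x A. var_eval x (scalar_mat z, scalar_mat w) * A) u (1\<^sub>m 1) = scalar_mat (word_scalar u z w)"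
    by (induction u z w rule: word_scalar.induct) (simp_all add: scalar_mat_arith del: One_nat_def)
  moreover have "dim_row (scalar_mat z) = 1" using scalar_mat_carrier by (rule carrier_matD)
  ultimately show ?thesis unfolding word_eval_def by simp
qed

definition poly_scalar :: "free_poly \<Rightarrow> complex \<Rightarrow> complex \<Rightarrow> complex" where
  "poly_scalar p z w = (\<Sum>u \<in> Poly_Mapping.keys p. Poly_Mapping.lookup p u * word_scalar u z w)"

lemma poly_eval_scalar: "poly_eval p (scalar_mat z, scalar_mat w) = scalar_mat (poly_scalar p z w)"
  unfolding poly_eval_def poly_scalar_def word_eval_scalar
  by (auto simp: scalar_mat_def intro!: eq_matI sum.cong)

lemma word_scalar_tendsto:
  assumes "f \<longlonglongrightarrow> z" "g \<longlonglongrightarrow> w"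
  shows "(\<lambda>k. word_scalar u (f k) (g k)) \<longlonglongrightarrow> word_scalar u z w"
proof (induction u)
  case (Cons x u)
  then show ?case using assms by (cases x) (auto intro: tendsto_mult)
qed simp

text \<open>At scalar points an expression is a rational function of two commuting variables. Its domain among them is
  open because a limit \<open>c \<noteq> 0\<close> keeps the matrices to be inverted away from \<open>0\<close>.\<close>

lemma expr_eval_scalar_tendsto:
  assumes "f \<longlonglongrightarrow> z" "g \<longlonglongrightarrow> w" "expr_eval e (scalar_mat z, scalar_mat w) = Some V"
  shows "\<exists>h c. V = scalar_mat c \<and> h \<longlonglongrightarrow> c \<and>
    (\<forall>\<^sub>F k in sequentially. expr_eval e (scalar_mat (f k), scalar_mat (g k)) = Some (scalar_mat (h k)))"
  using assms(3)
proof (induction e arbitrary: V)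
  case (Poly p)
  have "(\<lambda>k. poly_scalar p (f k) (g k)) \<longlonglongrightarrow> poly_scalar p z w"
    unfolding poly_scalar_def by (intro tendsto_sum tendsto_mult tendsto_const word_scalar_tendsto assms)
  then show ?case
    using Poly by (intro exI[of _ "\<lambda>k. poly_scalar p (f k) (g k)"] exI[of _ "poly_scalar p z w"])
      (simp add: poly_eval_scalar)
next
  case (Add a b)
  then obtain A B where AB: "expr_eval a (scalar_mat z, scalar_mat w) = Some A"
      "expr_eval b (scalar_mat z, scalar_mat w) = Some B" "V = A + B"
    by (auto split: option.splits)
  obtain h c where h: "A = scalar_mat c" "h \<longlonglongrightarrow> c"
    "\<forall>\<^sub>F k in sequentially. expr_eval a (scalar_mat (f k), scalar_mat (g k)) = Some (scalar_mat (h k))"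
    using Add.IH(1)[OF AB(1)] by blast
  obtain h' c' where h': "B = scalar_mat c'" "h' \<longlonglongrightarrow> c'"
    "\<forall>\<^sub>F k in sequentially. expr_eval b (scalar_mat (f k), scalar_mat (g k)) = Some (scalar_mat (h' k))"
    using Add.IH(2)[OF AB(2)] by blast
  have "\<forall>\<^sub>F k in sequentially.
      expr_eval (Add a b) (scalar_mat (f k), scalar_mat (g k)) = Some (scalar_mat (h k + h' k))"
    using h(3) h'(3) by eventually_elim (simp add: scalar_mat_arith)
  then show ?case
    using tendsto_add[OF h(2) h'(2)] unfolding AB(3) h(1) h'(1) scalar_mat_arith by blast
next
  case (Mult a b)
  then obtain A B where AB: "expr_eval a (scalar_mat z, scalar_mat w) = Some A"
      "expr_eval b (scalar_mat z, scalar_mat w) = Some B" "V = A * B"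
    by (auto split: option.splits)
  obtain h c where h: "A = scalar_mat c" "h \<longlonglongrightarrow> c"
    "\<forall>\<^sub>F k in sequentially. expr_eval a (scalar_mat (f k), scalar_mat (g k)) = Some (scalar_mat (h k))"
    using Mult.IH(1)[OF AB(1)] by blast
  obtain h' c' where h': "B = scalar_mat c'" "h' \<longlonglongrightarrow> c'"
    "\<forall>\<^sub>F k in sequentially. expr_eval b (scalar_mat (f k), scalar_mat (g k)) = Some (scalar_mat (h' k))"
    using Mult.IH(2)[OF AB(2)] by blast
  have "\<forall>\<^sub>F k in sequentially.
      expr_eval (Mult a b) (scalar_mat (f k), scalar_mat (g k)) = Some (scalar_mat (h k * h' k))"
    using h(3) h'(3) by eventually_elim (simp add: scalar_mat_arith)
  then show ?case
    using tendsto_mult[OF h(2) h'(2)] unfolding AB(3) h(1) h'(1) scalar_mat_arith by blast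
next
  case (Inv a)
  then obtain A where A: "expr_eval a (scalar_mat z, scalar_mat w) = Some A" "mat_inverse A = Some V"
    by (auto split: option.splits)
  obtain h c where h: "A = scalar_mat c" "h \<longlonglongrightarrow> c"
    "\<forall>\<^sub>F k in sequentially. expr_eval a (scalar_mat (f k), scalar_mat (g k)) = Some (scalar_mat (h k))"
    using Inv.IH[OF A(1)] by blast
  have c: "c \<noteq> 0" "V = scalar_mat (1 / c)" using mat_inverse_scalar_mat A(2) unfolding h(1) by auto
  have "\<forall>\<^sub>F k in sequentially. h k \<noteq> 0" by (rule tendsto_imp_eventually_ne[OF h(2) c(1)])
  with h(3) have "\<forall>\<^sub>F k in sequentially.
      expr_eval (Inv a) (scalar_mat (f k), scalar_mat (g k)) = Some (scalar_mat (1 / h k))"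
    by eventually_elim (simp add: mat_inverse_eq_Some[OF mutually_inverse_scalar_mat])
  then show ?case
    using tendsto_divide[OF tendsto_const h(2) c(1), of 1] c(2) by blast
qed

lemma eval_parallel_sum_expr_scalar:
  assumes "2 - z - w \<noteq> 0"
  shows "expr_eval parallel_sum_expr (scalar_mat z, scalar_mat w)
    = Some (scalar_mat ((1 - z) * (1 - w) / (2 - z - w)))"
proof -
  have eq: "(1\<^sub>m 1 - scalar_mat z) + (1\<^sub>m 1 - scalar_mat w) = scalar_mat (2 - z - w)"
    unfolding scalar_mat_arith by (simp add: scalar_mat_inject)
  show ?thesis
    unfolding eval_parallel_sum_expr_iff[OF scalar_mat_carrier scalar_mat_carrier] eq
    by (rule exI[of _ "scalar_mat (1 / (2 - z - w))"])
      (simp add: mutually_inverse_scalar_mat[OF assms] scalar_mat_arith scalar_mat_inject del: One_nat_def)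
qed

text \<open>Along \<open>z = 1 + t\<close>, \<open>w = 1 - t + t\<^sup>3\<close> the denominator \<open>2 - z - w\<close> is \<open>- t\<^sup>3\<close> while the numerator has
  order \<open>t\<^sup>2\<close>, so the values \<open>(1 - t\<^sup>2) / t\<close> are unbounded as \<open>t\<close> tends to \<open>0\<close>. An expression defined at
  \<open>(1, 1)\<close> would have a limit there.\<close>

lemma parallel_sum_singular_at_one:
  assumes e: "e \<in> parallel_sum"
  shows "(scalar_mat 1, scalar_mat 1) \<notin> expr_dom e"
proof
  assume "(scalar_mat 1, scalar_mat 1) \<in> expr_dom e"
  then obtain V where V: "expr_eval e (scalar_mat 1, scalar_mat 1) = Some V"
    unfolding expr_dom_def by auto
  define t :: "nat \<Rightarrow> complex" where "t k = complex_of_real (inverse (real (Suc k)))" for k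
  have t: "t \<longlonglongrightarrow> 0"
    unfolding t_def using tendsto_of_real[OF LIMSEQ_inverse_real_of_nat, where 'a = complex]
    by (simp only: of_real_0)
  have t0: "t k \<noteq> 0" for k unfolding t_def by (simp del: of_nat_Suc)
  define f where "f k = 1 + t k" for k
  define g where "g k = 1 - t k + t k ^ 3" for k
  have f: "f \<longlonglongrightarrow> 1" unfolding f_def using tendsto_add[OF tendsto_const t, of 1] by simp
  have g: "g \<longlonglongrightarrow> 1"
    unfolding g_def using tendsto_add[OF tendsto_diff[OF tendsto_const t, of 1] tendsto_power[OF t, of 3]] by simp
  obtain h c where h: "h \<longlonglongrightarrow> c"
    and eval: "\<forall>\<^sub>F k in sequentially. expr_eval e (scalar_mat (f k), scalar_mat (g k)) = Some (scalar_mat (h k))"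
    using expr_eval_scalar_tendsto[OF f g V] by blast
  from eval have "\<forall>\<^sub>F k in sequentially. h k * t k = 1 - t k ^ 2"
  proof eventually_elim
    case (elim k)
    have den: "2 - f k - g k = - (t k ^ 3)" unfolding f_def g_def by simp
    have ne: "2 - f k - g k \<noteq> 0" unfolding den using t0 by simp
    have "(scalar_mat (f k), scalar_mat (g k)) \<in> expr_dom e \<inter> expr_dom parallel_sum_expr"
      using elim eval_parallel_sum_expr_scalar[OF ne] scalar_point_in_nc_points unfolding expr_dom_def by simp
    then have "h k = (1 - f k) * (1 - g k) / (2 - f k - g k)"
      using expr_eval_in_class[OF e] elim eval_parallel_sum_expr_scalar[OF ne]
      by (auto simp: scalar_mat_inject)
    also have "\<dots> = (1 - t k ^ 2) / t k"
      unfolding den f_def g_def using t0[of k]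
      by (simp add: field_simps power2_eq_square power3_eq_cube)
    finally show ?case using t0[of k] by simp
  qed
  then have "(\<lambda>k. 1 - t k ^ 2) \<longlonglongrightarrow> c * 0"
    using tendsto_mult[OF h t] by (rule Lim_transform_eventually[rotated])
  moreover have "(\<lambda>k. 1 - t k ^ 2) \<longlonglongrightarrow> 1 - 0 ^ 2"
    by (intro tendsto_diff tendsto_const tendsto_power t)
  ultimately show False using LIMSEQ_unique by fastforce
qed

lemma one_one_in_scaled_bidisk:
  assumes "1 < s"
  shows "(scalar_mat 1, scalar_mat 1) \<in> scaled_bidisk s"
proof -
  let ?x = "scalar_mat (complex_of_real (1 / s))"
  have "op_norm ?x < 1"
    by (rule le_less_trans[OF op_norm_scalar_mat_le]) (use assms in \<open>simp add: norm_divide\<close>)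
  then have "(?x, ?x) \<in> bidisk"
    using bidisk_levelD(1)[OF bidisk_levelI[OF scalar_mat_carrier scalar_mat_carrier]] by simp
  moreover have "of_real s \<cdot>\<^sub>m ?x = scalar_mat 1"
    unfolding scalar_mat_arith using assms by (simp add: scalar_mat_inject)
  ultimately show ?thesis unfolding scaled_bidisk_def by (force intro!: image_eqI[of _ _ "(?x, ?x)"])
qed

section \<open>The NC parallel sum as a cyclic accretive function\<close>

theorem corollary5p6:
  shows "parallel_sum \<in> nc_rational_functions
    \<and> (parallel_sum_expr, parallel_sum_expr') \<in> expr_equiv
    \<and> bidisk \<subseteq> rat_dom parallel_sum
    \<and> (\<forall>P \<in> bidisk. expr_eval parallel_sum_expr P = Some (rat_apply parallel_sum P)
                    \<and> expr_eval parallel_sum_expr' P = Some (rat_apply parallel_sum P))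
    \<and> contractive_on_bidisk parallel_sum
    \<and> bidisk_stable parallel_sum
    \<and> accretive_on_bidisk parallel_sum
    \<and> \<not> (\<exists>s>1. scaled_bidisk s \<subseteq> rat_dom parallel_sum)
    \<and> left_cyclic (\<lambda>P \<in> bidisk. rat_apply parallel_sum P)
    \<and> right_cyclic (\<lambda>P \<in> bidisk. rat_apply parallel_sum P)"
proof (intro conjI)
  show "parallel_sum \<in> nc_rational_functions"
    unfolding nc_rational_functions_def parallel_sum_def
    by (rule quotientI[OF parallel_sum_expr_nondegenerate(1)])
  show "(parallel_sum_expr, parallel_sum_expr') \<in> expr_equiv" by (rule parallel_sum_exprs_equiv)
  show "bidisk \<subseteq> rat_dom parallel_sum"
    unfolding rat_dom_def using bidisk_subset_expr_dom(1) parallel_sum_expr_in_class by blast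
  show "\<forall>P \<in> bidisk. expr_eval parallel_sum_expr P = Some (rat_apply parallel_sum P)
      \<and> expr_eval parallel_sum_expr' P = Some (rat_apply parallel_sum P)"
    by (metis bidisk_obtain_level rat_apply_parallel_sum)
  show "contractive_on_bidisk parallel_sum"
    unfolding contractive_on_bidisk_def using op_norm_rat_apply_le by blast
  show "bidisk_stable parallel_sum"
    unfolding bidisk_stable_def
    by (metis bidisk_obtain_level rat_apply_parallel_sum mutually_inverse_det_nonzero)
  show "accretive_on_bidisk parallel_sum"
    unfolding accretive_on_bidisk_def
    by (metis bidisk_obtain_level rat_apply_carrier accretive_rat_apply psd_re_part)
  show "\<not> (\<exists>s>1. scaled_bidisk s \<subseteq> rat_dom parallel_sum)"
    using one_one_in_scaled_bidisk parallel_sum_singular_at_one unfolding rat_dom_def by blast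
  let ?F = "restrict (rat_apply parallel_sum) bidisk"
  have F: "?F \<in> hinf" by (rule hinfI[OF nc_function_parallel_sum op_norm_rat_apply_le])
  have accretive: "0 \<le> Re ((?F P *\<^sub>v v) \<bullet>c v)" if "P \<in> bidisk_level n" "v \<in> carrier_vec n" for n P v
    using accretive_rat_apply[OF that] bidisk_levelD(1)[OF that(1)] by simp
  have invertible: "\<exists>R. mutually_inverse n (?F P) R" if "P \<in> bidisk_level n" for n P
    using rat_apply_parallel_sum[OF that] bidisk_levelD(1)[OF that] by (metis restrict_apply')
  show "left_cyclic ?F" by (rule cyclic_if_accretive_invertible(1)[OF F]) (fact accretive invertible)+
  show "right_cyclic ?F" by (rule cyclic_if_accretive_invertible(2)[OF F]) (fact accretive invertible)+
qed

end
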